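(* Let $k$ be a field, $G$ a finite group, $\mathcal C\subset G$ a conjugacy class with base point $r$ and centraliser $C_G$ of $r$, and $\pi$ a finite-dimensional irreducible representation of $C_G$ over $k$. Then $\mathrm{End}(V_{\mathcal C,\pi})$, with basis $\{E_{ai}{}^{bj}\}$, is a $G$-crossed module by $$h\triangleright E_{ai}{}^{bj}=\pi(\zeta_a(h))^m{}_i\,\pi(\zeta_b(h)^{-1})^j{}_n\,E_{(hah^{-1})m}{}^{(hbh^{-1})n},\qquad|E_{ai}{}^{bj}|=ab^{-1},$$ and becomes a unital regular left braided-Lie algebra $\mathcal L_{\mathcal C,\pi}$ in the category of $G$-crossed modules with matrix coalgebra structure $$\Delta E_{ai}{}^{bj}=\sum_{c\in\mathcal C}E_{ai}{}^{cm}\otimes E_{cm}{}^{bj},\qquad\epsilon(E_{ai}{}^{bj})=\delta_{a,b}\,\delta_i^j,$$ braided-Lie bracket $$[E_{ai}{}^{bj},E_{cm}{}^{dl}]=\delta_{|E_{ai}{}^{bj}||E_{cm}{}^{dl}|,\,|b^{-1}\triangleright E_{cm}{}^{dl}|}\ \pi\big(\zeta_a(|b^{-1}\triangleright E_{cm}{}^{dl}|^{-1})\big)^j{}_i\ b^{-1}\triangleright E_{cm}{}^{dl},$$ and fundamental braiding $$\widetilde\Psi(E_{ai}{}^{bj}\otimes E_{cm}{}^{dl})=b^{-1}\triangleright E_{cm}{}^{dl}\otimes\big((|b^{-1}\triangleright E_{cm}{}^{dl}|^{-1}\triangleright E_{ai})\otimes E^{bj}\big).$$ There are similar formulae between blocks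 in the case of a direct sum $\bigoplus_{(\mathcal C,\pi)}\mathrm{End}(V_{\mathcal C,\pi})$ over a collection of non-trivial pairs: the bracket and fundamental braiding are given by the same expressions with $E_{cm}{}^{dl}$ taken in the block of a second pair $(\mathcal C',\pi')$, and the coalgebra is the direct sum one.
   Context: Repeated $V_\pi$-indices are summed. Fix $q:\mathcal C\to G$ with $q_crq_c^{-1}=c$ and $q_r=e$, and set $\zeta_c(g)=q_{gcg^{-1}}^{-1}gq_c\in C_G$. $V_{\mathcal C,\pi}=k\mathcal C\otimes V_\pi$ has basis $E_{ci}=c\otimes v_i$, where $\{v_i\}$ is a basis of $V_\pi$, with $G$-crossed module structure $h\triangleright E_{ci}=\pi(\zeta_c(h))^j{}_iE_{(hch^{-1})j}$, $|E_{ci}|=c$. $E^{ci}$ is the dual basis, with $h\triangleright E^{ci}=\pi(\zeta_c(h)^{-1})^i{}_jE^{(hch^{-1})j}$, $|E^{ci}|=c^{-1}$, and $E_{ai}{}^{bj}=E_{ai}\otimes E^{bj}$ is the basis of $\mathrm{End}(V_{\mathcal C,\pi})$. In $\delta_{x,y}$ with $x,y\in G$ the symbol is the Kronecker delta. A pair is non-trivial if it is not $(\{e\},1)$. A $G$-crossed module is a $G$-graded vector space with left $G$-action such that $|h\triangleright v|=h|v|h^{-1}$; these form a braided category with $\Psi(v\otimes w)=|v|\triangleright w\otimes v$ and unit object $\underline 1=k$. A left braided-Lie algebra in a braided category is a counital coalgebra $(\mathcal L,\Delta,\epsilon)$ in the category with a morphism $[\ ,\ ]:\mathcal L\otimes\mathcal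 L\to\mathcal L$ such that, with $\widetilde\Psi=([\ ,\ ]\otimes\mathrm{id})(\mathrm{id}\otimes\Psi)(\Delta\otimes\mathrm{id})$ (the fundamental braiding): (L1) $[\ ,\ ](\mathrm{id}\otimes[\ ,\ ])=[\ ,\ ]([\ ,\ ]\otimes[\ ,\ ])(\mathrm{id}\otimes\Psi\otimes\mathrm{id})(\Delta\otimes\mathrm{id}\otimes\mathrm{id})$; (L2) $\Psi\circ\widetilde\Psi=(\mathrm{id}\otimes[\ ,\ ])(\Delta\otimes\mathrm{id})$; (L3) $\Delta[\ ,\ ]=([\ ,\ ]\otimes[\ ,\ ])(\mathrm{id}\otimes\Psi\otimes\mathrm{id})(\Delta\otimes\Delta)$ and $\epsilon[\ ,\ ]=\epsilon\otimes\epsilon$. It is regular if $\widetilde\Psi$ is invertible. It is unital if there exists a map of coalgebras $\eta:\underline 1\to\mathcal L$ (with $\underline 1$ grouplike) such that additionally (L4) $[\ ,\ ](\eta\otimes\mathrm{id})=\mathrm{id}$ and $[\ ,\ ](\mathrm{id}\otimes\eta)=\eta\circ\epsilon$.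
   Formalization: "Unital" fails for a single block unless |C|·dim π = 1, since a larger matrix coalgebra has no grouplike element; it is replaced by: unital iff |C|·dim π = 1, and the direct sum of non-trivial blocks with the block of the trivial pair ({e},1) is unital. *)

theory Defs
  imports Complex_Main "HOL-Algebra.Group" "HOL-Library.Poly_Mapping"
begin

text \<open>
  The vector space with basis \<open>X \<subseteq> 'x\<close> is the set of all \<open>v :: 'x \<Rightarrow>\<^sub>0 'k\<close> with
  \<open>keys v \<subseteq> X\<close>.  A linear map out of it is given by its values on \<open>X\<close>, i.e. by a function
  \<open>f :: 'x \<Rightarrow> ('y \<Rightarrow>\<^sub>0 'k)\<close> of which only the restriction to \<open>X\<close> matters; \<open>lin f\<close> is its
  linear extension.  The tensor product of the spaces with bases \<open>X\<close> and \<open>Y\<close> has basis \<open>X \<times> Y\<close>.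
\<close>

definition scl :: "'k::field \<Rightarrow> ('x \<Rightarrow>\<^sub>0 'k) \<Rightarrow> ('x \<Rightarrow>\<^sub>0 'k)" where
  "scl c v = Poly_Mapping.map ((*) c) v"

abbreviation bas :: "'x \<Rightarrow> ('x \<Rightarrow>\<^sub>0 'k::field)" where
  "bas x \<equiv> Poly_Mapping.single x 1"

definition lin :: "('x \<Rightarrow> ('y \<Rightarrow>\<^sub>0 'k)) \<Rightarrow> ('x \<Rightarrow>\<^sub>0 'k::field) \<Rightarrow> ('y \<Rightarrow>\<^sub>0 'k)" where
  "lin f v = (\<Sum>x\<in>Poly_Mapping.keys v. scl (Poly_Mapping.lookup v x) (f x))"

definition tens :: "('x \<Rightarrow>\<^sub>0 'k) \<Rightarrow> ('y \<Rightarrow>\<^sub>0 'k::field) \<Rightarrow> ('x \<times> 'y \<Rightarrow>\<^sub>0 'k)" where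
  "tens v w = (\<Sum>x\<in>Poly_Mapping.keys v. \<Sum>y\<in>Poly_Mapping.keys w.
     Poly_Mapping.single (x, y) (Poly_Mapping.lookup v x * Poly_Mapping.lookup w y))"

definition mcomp :: "('y \<Rightarrow> ('z \<Rightarrow>\<^sub>0 'k)) \<Rightarrow> ('x \<Rightarrow> ('y \<Rightarrow>\<^sub>0 'k::field)) \<Rightarrow> 'x \<Rightarrow> ('z \<Rightarrow>\<^sub>0 'k)"
    (infixr "\<bullet>" 60) where
  "(f \<bullet> g) x = lin f (g x)"

definition mtens :: "('x \<Rightarrow> ('x' \<Rightarrow>\<^sub>0 'k)) \<Rightarrow> ('y \<Rightarrow> ('y' \<Rightarrow>\<^sub>0 'k::field)) \<Rightarrow> 'x \<times> 'y \<Rightarrow> ('x' \<times> 'y' \<Rightarrow>\<^sub>0 'k)"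
    (infixr "\<boxtimes>" 65) where
  "(f \<boxtimes> g) = (\<lambda>(x, y). tens (f x) (g y))"

abbreviation idm :: "'x \<Rightarrow> ('x \<Rightarrow>\<^sub>0 'k::field)" where
  "idm \<equiv> bas"

definition assoc_r :: "('x \<times> 'y) \<times> 'z \<Rightarrow> ('x \<times> 'y \<times> 'z \<Rightarrow>\<^sub>0 'k::field)" where
  "assoc_r = (\<lambda>((x, y), z). bas (x, y, z))"

definition assoc_l :: "'x \<times> 'y \<times> 'z \<Rightarrow> (('x \<times> 'y) \<times> 'z \<Rightarrow>\<^sub>0 'k::field)" where
  "assoc_l = (\<lambda>(x, y, z). bas ((x, y), z))"

definition unitor_l :: "unit \<times> 'x \<Rightarrow> ('x \<Rightarrow>\<^sub>0 'k::field)" where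
  "unitor_l = (\<lambda>(u, x). bas x)"

definition unitor_r :: "'x \<times> unit \<Rightarrow> ('x \<Rightarrow>\<^sub>0 'k::field)" where
  "unitor_r = (\<lambda>(x, u). bas x)"

text \<open>\<open>mid f\<close> is the map \<open>id \<otimes> f \<otimes> id\<close> on a fourfold tensor product bracketed as
  \<open>(X \<otimes> Y) \<otimes> (Z \<otimes> W)\<close>.\<close>

definition mid :: "('y \<times> 'z \<Rightarrow> ('y' \<times> 'z' \<Rightarrow>\<^sub>0 'k::field)) \<Rightarrow>
    ('x \<times> 'y) \<times> ('z \<times> 'w) \<Rightarrow> (('x \<times> 'y') \<times> ('z' \<times> 'w) \<Rightarrow>\<^sub>0 'k)" where
  "mid f = assoc_l \<bullet> (idm \<boxtimes> (assoc_r \<bullet> (f \<boxtimes> idm) \<bullet> assoc_l)) \<bullet> assoc_r"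


section \<open>Crossed modules\<close>

text \<open>A \<open>G\<close>-graded vector space is given by a basis of homogeneous elements.\<close>

record (overloaded) ('x, 'g, 'k) crossed =
  basis :: "'x set"
  bdeg :: "'x \<Rightarrow> 'g"
  act :: "'g \<Rightarrow> 'x \<Rightarrow> ('x \<Rightarrow>\<^sub>0 'k::zero)"

definition crossed_module ::
    "('g, 'a) monoid_scheme \<Rightarrow> ('x, 'g, 'k::field, 'b) crossed_scheme \<Rightarrow> bool" where
  "crossed_module G M \<longleftrightarrow>
     (\<forall>x\<in>basis M. bdeg M x \<in> carrier G) \<and>
     (\<forall>h\<in>carrier G. \<forall>x\<in>basis M. Poly_Mapping.keys (act M h x) \<subseteq> basis M) \<and>
     (\<forall>x\<in>basis M. act M \<one>\<^bsub>G\<^esub> x = bas x) \<and>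
     (\<forall>g\<in>carrier G. \<forall>h\<in>carrier G. \<forall>x\<in>basis M.
        act M (g \<otimes>\<^bsub>G\<^esub> h) x = lin (act M g) (act M h x)) \<and>
     (\<forall>h\<in>carrier G. \<forall>x\<in>basis M. \<forall>y\<in>Poly_Mapping.keys (act M h x).
        bdeg M y = h \<otimes>\<^bsub>G\<^esub> bdeg M x \<otimes>\<^bsub>G\<^esub> inv\<^bsub>G\<^esub> h)"

text \<open>Degree of a nonzero homogeneous element.\<close>

definition hdeg :: "('x, 'g, 'k::field, 'b) crossed_scheme \<Rightarrow> ('x \<Rightarrow>\<^sub>0 'k) \<Rightarrow> 'g" where
  "hdeg M v = (THE g. \<forall>x\<in>Poly_Mapping.keys v. bdeg M x = g)"

definition crossed_morphism :: "('g, 'a) monoid_scheme \<Rightarrow> ('x, 'g, 'k::field, 'b) crossed_scheme \<Rightarrow>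
    ('y, 'g, 'k, 'c) crossed_scheme \<Rightarrow> ('x \<Rightarrow> ('y \<Rightarrow>\<^sub>0 'k)) \<Rightarrow> bool" where
  "crossed_morphism G M N f \<longleftrightarrow>
     (\<forall>x\<in>basis M. Poly_Mapping.keys (f x) \<subseteq> basis N) \<and>
     (\<forall>x\<in>basis M. \<forall>y\<in>Poly_Mapping.keys (f x). bdeg N y = bdeg M x) \<and>
     (\<forall>h\<in>carrier G. \<forall>x\<in>basis M. lin f (act M h x) = lin (act N h) (f x))"

definition crossed_iso :: "('g, 'a) monoid_scheme \<Rightarrow> ('x, 'g, 'k::field, 'b) crossed_scheme \<Rightarrow>
    ('y, 'g, 'k, 'c) crossed_scheme \<Rightarrow> ('x \<Rightarrow> ('y \<Rightarrow>\<^sub>0 'k)) \<Rightarrow> bool" where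
  "crossed_iso G M N f \<longleftrightarrow> crossed_morphism G M N f \<and>
     (\<exists>g. crossed_morphism G N M g \<and>
        (\<forall>x\<in>basis M. (g \<bullet> f) x = idm x) \<and> (\<forall>y\<in>basis N. (f \<bullet> g) y = idm y))"

definition tensor_crossed :: "('g, 'a) monoid_scheme \<Rightarrow> ('x, 'g, 'k::field, 'b) crossed_scheme \<Rightarrow>
    ('y, 'g, 'k, 'c) crossed_scheme \<Rightarrow> ('x \<times> 'y, 'g, 'k) crossed" where
  "tensor_crossed G M N = \<lparr>basis = basis M \<times> basis N,
     bdeg = (\<lambda>(x, y). bdeg M x \<otimes>\<^bsub>G\<^esub> bdeg N y),
     act = (\<lambda>h. act M h \<boxtimes> act N h)\<rparr>"

definition unit_crossed :: "('g, 'a) monoid_scheme \<Rightarrow> (unit, 'g, 'k::field) crossed" where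
  "unit_crossed G = \<lparr>basis = {()}, bdeg = (\<lambda>_. \<one>\<^bsub>G\<^esub>), act = (\<lambda>h. idm)\<rparr>"

definition braiding :: "('x, 'g, 'k::field, 'b) crossed_scheme \<Rightarrow>
    ('y, 'g, 'k, 'c) crossed_scheme \<Rightarrow> 'x \<times> 'y \<Rightarrow> ('y \<times> 'x \<Rightarrow>\<^sub>0 'k)" where
  "braiding M N = (\<lambda>(x, y). tens (act N (bdeg M x) y) (bas x))"


section \<open>Braided-Lie algebras\<close>

record (overloaded) ('x, 'g, 'k) braided_alg = "('x, 'g, 'k::zero) crossed" +
  comult :: "'x \<Rightarrow> ('x \<times> 'x \<Rightarrow>\<^sub>0 'k)"
  counit :: "'x \<Rightarrow> (unit \<Rightarrow>\<^sub>0 'k)"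
  bracket :: "'x \<times> 'x \<Rightarrow> ('x \<Rightarrow>\<^sub>0 'k)"

definition coalgebra_in_crossed ::
    "('g, 'a) monoid_scheme \<Rightarrow> ('x, 'g, 'k::field, 'b) braided_alg_scheme \<Rightarrow> bool" where
  "coalgebra_in_crossed G L \<longleftrightarrow>
     crossed_module G L \<and>
     crossed_morphism G L (tensor_crossed G L L) (comult L) \<and>
     crossed_morphism G L (unit_crossed G) (counit L) \<and>
     (\<forall>x\<in>basis L.
        (assoc_r \<bullet> (comult L \<boxtimes> idm) \<bullet> comult L) x = ((idm \<boxtimes> comult L) \<bullet> comult L) x \<and>
        (unitor_l \<bullet> (counit L \<boxtimes> idm) \<bullet> comult L) x = idm x \<and>
        (unitor_r \<bullet> (idm \<boxtimes> counit L) \<bullet> comult L) x = idm x)"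

definition fund_braiding ::
    "('x, 'g, 'k::field, 'b) braided_alg_scheme \<Rightarrow> 'x \<times> 'x \<Rightarrow> ('x \<times> 'x \<Rightarrow>\<^sub>0 'k)" where
  "fund_braiding L =
     (bracket L \<boxtimes> idm) \<bullet> assoc_l \<bullet> (idm \<boxtimes> braiding L L) \<bullet> assoc_r \<bullet> (comult L \<boxtimes> idm)"

definition left_braided_Lie_algebra ::
    "('g, 'a) monoid_scheme \<Rightarrow> ('x, 'g, 'k::field, 'b) braided_alg_scheme \<Rightarrow> bool" where
  "left_braided_Lie_algebra G L \<longleftrightarrow>
     coalgebra_in_crossed G L \<and>
     crossed_morphism G (tensor_crossed G L L) L (bracket L) \<and>
     \<comment> \<open>L1\<close>
     (\<forall>t\<in>basis L \<times> basis L \<times> basis L.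
        (bracket L \<bullet> (idm \<boxtimes> bracket L)) t =
        (bracket L \<bullet> (bracket L \<boxtimes> bracket L) \<bullet> mid (braiding L L) \<bullet> (comult L \<boxtimes> idm)) t) \<and>
     \<comment> \<open>L2\<close>
     (\<forall>t\<in>basis L \<times> basis L.
        (braiding L L \<bullet> fund_braiding L) t =
        ((idm \<boxtimes> bracket L) \<bullet> assoc_r \<bullet> (comult L \<boxtimes> idm)) t) \<and>
     \<comment> \<open>L3\<close>
     (\<forall>t\<in>basis L \<times> basis L.
        (comult L \<bullet> bracket L) t =
        ((bracket L \<boxtimes> bracket L) \<bullet> mid (braiding L L) \<bullet> (comult L \<boxtimes> comult L)) t \<and>
        (counit L \<bullet> bracket L) t = (unitor_l \<bullet> (counit L \<boxtimes> counit L)) t)"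

definition regular :: "('g, 'a) monoid_scheme \<Rightarrow> ('x, 'g, 'k::field, 'b) braided_alg_scheme \<Rightarrow> bool" where
  "regular G L \<longleftrightarrow> crossed_iso G (tensor_crossed G L L) (tensor_crossed G L L) (fund_braiding L)"

text \<open>The comultiplication of the grouplike unit object is \<open>() \<mapsto> () \<otimes> ()\<close>.\<close>

definition unital :: "('g, 'a) monoid_scheme \<Rightarrow> ('x, 'g, 'k::field, 'b) braided_alg_scheme \<Rightarrow> bool" where
  "unital G L \<longleftrightarrow> (\<exists>\<eta> :: unit \<Rightarrow> ('x \<Rightarrow>\<^sub>0 'k).
     crossed_morphism G (unit_crossed G) L \<eta> \<and>
     (comult L \<bullet> \<eta>) () = (\<eta> \<boxtimes> \<eta>) ((), ()) \<and>
     (counit L \<bullet> \<eta>) () = bas () \<and>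
     \<comment> \<open>L4\<close>
     (\<forall>x\<in>basis L.
        (bracket L \<bullet> (\<eta> \<boxtimes> idm)) ((), x) = unitor_l ((), x) \<and>
        (bracket L \<bullet> (idm \<boxtimes> \<eta>)) (x, ()) = (\<eta> \<bullet> counit L \<bullet> unitor_r) (x, ())))"


section \<open>Conjugacy classes and representations of centralisers\<close>

definition centraliser :: "('g, 'a) monoid_scheme \<Rightarrow> 'g \<Rightarrow> 'g set" where
  "centraliser G r = {g \<in> carrier G. g \<otimes>\<^bsub>G\<^esub> r = r \<otimes>\<^bsub>G\<^esub> g}"

definition conj_class :: "('g, 'a) monoid_scheme \<Rightarrow> 'g \<Rightarrow> 'g set" where
  "conj_class G r = {g \<otimes>\<^bsub>G\<^esub> r \<otimes>\<^bsub>G\<^esub> inv\<^bsub>G\<^esub> g | g. g \<in> carrier G}"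

definition is_representation :: "('g, 'a) monoid_scheme \<Rightarrow> 'g set \<Rightarrow>
    ('k::field \<Rightarrow> 'v::ab_group_add \<Rightarrow> 'v) \<Rightarrow> 'v set \<Rightarrow> ('g \<Rightarrow> 'v \<Rightarrow> 'v) \<Rightarrow> bool" where
  "is_representation G H scale V \<rho> \<longleftrightarrow>
     (\<forall>h\<in>H. \<forall>u\<in>V. \<forall>v\<in>V. \<forall>c. \<rho> h u \<in> V \<and> \<rho> h (u + v) = \<rho> h u + \<rho> h v \<and>
        \<rho> h (scale c v) = scale c (\<rho> h v)) \<and>
     (\<forall>v\<in>V. \<rho> \<one>\<^bsub>G\<^esub> v = v) \<and>
     (\<forall>g\<in>H. \<forall>h\<in>H. \<forall>v\<in>V. \<rho> (g \<otimes>\<^bsub>G\<^esub> h) v = \<rho> g (\<rho> h v))"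

definition is_irreducible :: "('g, 'a) monoid_scheme \<Rightarrow> 'g set \<Rightarrow>
    ('k::field \<Rightarrow> 'v::ab_group_add \<Rightarrow> 'v) \<Rightarrow> 'v set \<Rightarrow> ('g \<Rightarrow> 'v \<Rightarrow> 'v) \<Rightarrow> bool" where
  "is_irreducible G H scale V \<rho> \<longleftrightarrow>
     is_representation G H scale V \<rho> \<and> V \<noteq> {0} \<and>
     (\<forall>W. module.subspace scale W \<longrightarrow> W \<subseteq> V \<longrightarrow> (\<forall>h\<in>H. \<rho> h ` W \<subseteq> W) \<longrightarrow> W = {0} \<or> W = V)"

text \<open>The data \<open>(C, \<pi>)\<close> together with the choices of \<open>r\<close>, \<open>q\<close> and of a basis \<open>{v\<^sub>i}\<close> of
  \<open>V\<^sub>\<pi>\<close>; the index \<open>i\<close> of a basis vector is the vector itself.\<close>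

record ('g, 'v) pair_data =
  cls :: "'g set"
  base :: "'g"
  qmap :: "'g \<Rightarrow> 'g"
  vbasis :: "'v set"
  rep :: "'g \<Rightarrow> 'v \<Rightarrow> 'v"

definition class_irrep_pair :: "('g, 'a) monoid_scheme \<Rightarrow>
    ('k::field \<Rightarrow> 'v::ab_group_add \<Rightarrow> 'v) \<Rightarrow> ('g, 'v) pair_data \<Rightarrow> bool" where
  "class_irrep_pair G scale p \<longleftrightarrow>
     base p \<in> carrier G \<and> cls p = conj_class G (base p) \<and>
     (\<forall>c\<in>cls p. qmap p c \<in> carrier G \<and>
        qmap p c \<otimes>\<^bsub>G\<^esub> base p \<otimes>\<^bsub>G\<^esub> inv\<^bsub>G\<^esub> (qmap p c) = c) \<and>
     qmap p (base p) = \<one>\<^bsub>G\<^esub> \<and>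
     finite (vbasis p) \<and> \<not> module.dependent scale (vbasis p) \<and>
     is_irreducible G (centraliser G (base p)) scale (module.span scale (vbasis p)) (rep p)"

definition trivial_pair :: "('g, 'a) monoid_scheme \<Rightarrow> ('k::field \<Rightarrow> 'v::ab_group_add \<Rightarrow> 'v) \<Rightarrow>
    ('g, 'v) pair_data \<Rightarrow> bool" where
  "trivial_pair G scale p \<longleftrightarrow> cls p = {\<one>\<^bsub>G\<^esub>} \<and> card (vbasis p) = 1 \<and>
     (\<forall>h\<in>carrier G. \<forall>v\<in>module.span scale (vbasis p). rep p h v = v)"

definition zeta :: "('g, 'a) monoid_scheme \<Rightarrow> ('g, 'v) pair_data \<Rightarrow> 'g \<Rightarrow> 'g \<Rightarrow> 'g" where
  "zeta G p c g = inv\<^bsub>G\<^esub> (qmap p (g \<otimes>\<^bsub>G\<^esub> c \<otimes>\<^bsub>G\<^esub> inv\<^bsub>G\<^esub> g)) \<otimes>\<^bsub>G\<^esub> g \<otimes>\<^bsub>G\<^esub> qmap p c"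

text \<open>\<open>mat scale p h j i\<close> is the matrix coefficient \<open>\<pi>(h)\<^sup>j\<^sub>i\<close>, i.e. the coefficient of
  \<open>v\<^sub>j\<close> in \<open>\<pi>(h) v\<^sub>i\<close>.\<close>

definition mat :: "('k::field \<Rightarrow> 'v::ab_group_add \<Rightarrow> 'v) \<Rightarrow> ('g, 'v) pair_data \<Rightarrow>
    'g \<Rightarrow> 'v \<Rightarrow> 'v \<Rightarrow> 'k" where
  "mat scale p h j i = module.representation scale (vbasis p) (rep p h i) j"


section \<open>The block of a pair\<close>

text \<open>The basis elements \<open>E\<^sub>c\<^sub>i\<close> and \<open>E\<^sup>c\<^sup>i\<close> are both indexed by \<open>(c, i)\<close>, and
  \<open>E\<^sub>a\<^sub>i\<^sup>b\<^sup>j = E\<^sub>a\<^sub>i \<otimes> E\<^sup>b\<^sup>j\<close> by \<open>((a, i), (b, j))\<close>.\<close>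

definition V_cr :: "('g, 'a) monoid_scheme \<Rightarrow> ('k::field \<Rightarrow> 'v::ab_group_add \<Rightarrow> 'v) \<Rightarrow>
    ('g, 'v) pair_data \<Rightarrow> ('g \<times> 'v, 'g, 'k) crossed" where
  "V_cr G scale p = \<lparr>basis = cls p \<times> vbasis p, bdeg = fst,
     act = (\<lambda>h (c, i). \<Sum>j\<in>vbasis p.
       Poly_Mapping.single (h \<otimes>\<^bsub>G\<^esub> c \<otimes>\<^bsub>G\<^esub> inv\<^bsub>G\<^esub> h, j) (mat scale p (zeta G p c h) j i))\<rparr>"

definition V_dual_cr :: "('g, 'a) monoid_scheme \<Rightarrow> ('k::field \<Rightarrow> 'v::ab_group_add \<Rightarrow> 'v) \<Rightarrow>
    ('g, 'v) pair_data \<Rightarrow> ('g \<times> 'v, 'g, 'k) crossed" where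
  "V_dual_cr G scale p = \<lparr>basis = cls p \<times> vbasis p, bdeg = (\<lambda>(c, i). inv\<^bsub>G\<^esub> c),
     act = (\<lambda>h (c, i). \<Sum>j\<in>vbasis p.
       Poly_Mapping.single (h \<otimes>\<^bsub>G\<^esub> c \<otimes>\<^bsub>G\<^esub> inv\<^bsub>G\<^esub> h, j)
         (mat scale p (inv\<^bsub>G\<^esub> (zeta G p c h)) i j))\<rparr>"

definition End_cr :: "('g, 'a) monoid_scheme \<Rightarrow> ('k::field \<Rightarrow> 'v::ab_group_add \<Rightarrow> 'v) \<Rightarrow>
    ('g, 'v) pair_data \<Rightarrow> (('g \<times> 'v) \<times> ('g \<times> 'v), 'g, 'k) crossed" where
  "End_cr G scale p = tensor_crossed G (V_cr G scale p) (V_dual_cr G scale p)"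

definition End_comult :: "('g, 'v) pair_data \<Rightarrow> ('g \<times> 'v) \<times> ('g \<times> 'v) \<Rightarrow>
    ((('g \<times> 'v) \<times> ('g \<times> 'v)) \<times> (('g \<times> 'v) \<times> ('g \<times> 'v)) \<Rightarrow>\<^sub>0 'k::field)" where
  "End_comult p = (\<lambda>((a, i), (b, j)). \<Sum>c\<in>cls p. \<Sum>m\<in>vbasis p.
     bas (((a, i), (c, m)), ((c, m), (b, j))))"

definition End_counit :: "('g \<times> 'v) \<times> ('g \<times> 'v) \<Rightarrow> (unit \<Rightarrow>\<^sub>0 'k::field)" where
  "End_counit = (\<lambda>((a, i), (b, j)).
     Poly_Mapping.single () ((if a = b then 1 else 0) * (if i = j then 1 else 0)))"

text \<open>Bracket of \<open>E\<^sub>a\<^sub>i\<^sup>b\<^sup>j\<close> in the block of \<open>p\<close> with \<open>E\<^sub>c\<^sub>m\<^sup>d\<^sup>l\<close> in the block of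
  \<open>p'\<close>, and the expression for the fundamental braiding of the same elements.\<close>

definition End_bracket :: "('g, 'a) monoid_scheme \<Rightarrow> ('k::field \<Rightarrow> 'v::ab_group_add \<Rightarrow> 'v) \<Rightarrow>
    ('g, 'v) pair_data \<Rightarrow> ('g, 'v) pair_data \<Rightarrow> ('g \<times> 'v) \<times> ('g \<times> 'v) \<Rightarrow>
    ('g \<times> 'v) \<times> ('g \<times> 'v) \<Rightarrow> (('g \<times> 'v) \<times> ('g \<times> 'v) \<Rightarrow>\<^sub>0 'k)" where
  "End_bracket G scale p p' = (\<lambda>((a, i), (b, j)) y.
     let y' = act (End_cr G scale p') (inv\<^bsub>G\<^esub> b) y;
         d = hdeg (End_cr G scale p') y'
     in scl ((if bdeg (End_cr G scale p) ((a, i), (b, j)) \<otimes>\<^bsub>G\<^esub> bdeg (End_cr G scale p') y = d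
              then 1 else 0) * mat scale p (zeta G p a (inv\<^bsub>G\<^esub> d)) j i) y')"

definition End_fund_fst :: "('g, 'a) monoid_scheme \<Rightarrow> ('k::field \<Rightarrow> 'v::ab_group_add \<Rightarrow> 'v) \<Rightarrow>
    ('g, 'v) pair_data \<Rightarrow> ('g, 'v) pair_data \<Rightarrow> ('g \<times> 'v) \<times> ('g \<times> 'v) \<Rightarrow>
    ('g \<times> 'v) \<times> ('g \<times> 'v) \<Rightarrow> (('g \<times> 'v) \<times> ('g \<times> 'v) \<Rightarrow>\<^sub>0 'k)" where
  "End_fund_fst G scale p p' = (\<lambda>((a, i), (b, j)) y. act (End_cr G scale p') (inv\<^bsub>G\<^esub> b) y)"

definition End_fund_snd :: "('g, 'a) monoid_scheme \<Rightarrow> ('k::field \<Rightarrow> 'v::ab_group_add \<Rightarrow> 'v) \<Rightarrow>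
    ('g, 'v) pair_data \<Rightarrow> ('g, 'v) pair_data \<Rightarrow> ('g \<times> 'v) \<times> ('g \<times> 'v) \<Rightarrow>
    ('g \<times> 'v) \<times> ('g \<times> 'v) \<Rightarrow> (('g \<times> 'v) \<times> ('g \<times> 'v) \<Rightarrow>\<^sub>0 'k)" where
  "End_fund_snd G scale p p' = (\<lambda>((a, i), (b, j)) y.
     let d = hdeg (End_cr G scale p') (act (End_cr G scale p') (inv\<^bsub>G\<^esub> b) y)
     in tens (act (V_cr G scale p) (inv\<^bsub>G\<^esub> d) (a, i)) (bas (b, j)))"

definition End_alg :: "('g, 'a) monoid_scheme \<Rightarrow> ('k::field \<Rightarrow> 'v::ab_group_add \<Rightarrow> 'v) \<Rightarrow>
    ('g, 'v) pair_data \<Rightarrow> (('g \<times> 'v) \<times> ('g \<times> 'v), 'g, 'k) braided_alg" where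
  "End_alg G scale p = \<lparr>basis = basis (End_cr G scale p), bdeg = bdeg (End_cr G scale p),
     act = act (End_cr G scale p), comult = End_comult p, counit = End_counit,
     bracket = (\<lambda>(x, y). End_bracket G scale p p x y)\<rparr>"


section \<open>Direct sums of blocks\<close>

definition incl :: "'i \<Rightarrow> ('x \<Rightarrow>\<^sub>0 'k::field) \<Rightarrow> ('i \<times> 'x \<Rightarrow>\<^sub>0 'k)" where
  "incl i v = lin (\<lambda>x. bas (i, x)) v"

definition sum_alg :: "('g, 'a) monoid_scheme \<Rightarrow> ('k::field \<Rightarrow> 'v::ab_group_add \<Rightarrow> 'v) \<Rightarrow>
    'i set \<Rightarrow> ('i \<Rightarrow> ('g, 'v) pair_data) \<Rightarrow>
    ('i \<times> (('g \<times> 'v) \<times> ('g \<times> 'v)), 'g, 'k) braided_alg" where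
  "sum_alg G scale I P = \<lparr>
     basis = (SIGMA s:I. basis (End_cr G scale (P s))),
     bdeg = (\<lambda>(s, x). bdeg (End_cr G scale (P s)) x),
     act = (\<lambda>h (s, x). incl s (act (End_cr G scale (P s)) h x)),
     comult = (\<lambda>(s, x). lin (\<lambda>(y, z). bas ((s, y), (s, z))) (End_comult (P s) x)),
     counit = (\<lambda>(s, x). End_counit x),
     bracket = (\<lambda>((s, x), (t, y)). incl t (End_bracket G scale (P s) (P t) x y))\<rparr>"


section \<open>Units\<close>

text \<open>
  A coalgebra map \<open>\<eta> : 1 \<rightarrow> L\<close> is a grouplike element of \<open>L\<close>, and a matrix coalgebra of
  size \<open>n \<noteq> 1\<close> has none.  So \<open>End(V)\<close> itself is not unital unless \<open>V\<close> is one-dimensional;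
  a unit in general comes from adjoining the block \<open>k\<close> of the trivial pair \<open>({e}, 1)\<close>.
\<close>

lemma lookup_lin:
  "Poly_Mapping.lookup (lin f v) y =
   (\<Sum>x\<in>Poly_Mapping.keys v. Poly_Mapping.lookup v x * Poly_Mapping.lookup (f x) y)"
  by (auto simp: lin_def scl_def lookup_sum Poly_Mapping.map.rep_eq when_def intro!: sum.cong)

lemma lookup_tens:
  "Poly_Mapping.lookup (tens v w) (x, y) = Poly_Mapping.lookup v x * Poly_Mapping.lookup w y"
proof -
  have "Poly_Mapping.lookup (tens v w) (x, y) = (\<Sum>x'\<in>Poly_Mapping.keys v. \<Sum>y'\<in>Poly_Mapping.keys w.
     if x' = x then if y' = y then Poly_Mapping.lookup v x * Poly_Mapping.lookup w y else 0 else 0)"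
    unfolding tens_def lookup_sum
    by (intro sum.cong refl) (auto simp: lookup_single when_def)
  also have "\<dots> = (\<Sum>x'\<in>Poly_Mapping.keys v. if x' = x then (\<Sum>y'\<in>Poly_Mapping.keys w.
     if y' = y then Poly_Mapping.lookup v x * Poly_Mapping.lookup w y else 0) else 0)"
    by (intro sum.cong refl) auto
  also have "\<dots> = Poly_Mapping.lookup v x * Poly_Mapping.lookup w y"
    by (auto simp: in_keys_iff sum.delta)
  finally show ?thesis .
qed

lemma lookup_End_comult:
  assumes "finite (cls p)" "finite (vbasis p)"
  shows "Poly_Mapping.lookup (End_comult p (P, Q)) ((P', S), (T, Q')) =
    (if P = P' \<and> Q = Q' \<and> S = T \<and> S \<in> cls p \<times> vbasis p then 1 else 0)"
proof -
  obtain a i b j where PQ: "P = (a, i)" "Q = (b, j)" by (metis surj_pair)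
  have *: "End_comult p (P, Q) = (\<Sum>s\<in>cls p \<times> vbasis p. bas ((P, s), (s, Q)))"
    by (simp add: PQ End_comult_def sum.cartesian_product case_prod_beta)
  have "Poly_Mapping.lookup (End_comult p (P, Q)) ((P', S), (T, Q')) =
      (\<Sum>s\<in>cls p \<times> vbasis p. if s = S then (if P = P' \<and> Q = Q' \<and> S = T then 1 else 0) else 0)"
    unfolding * lookup_sum by (rule sum.cong[OF refl]) (simp add: lookup_single when_def conj_ac)
  also have "\<dots> = (if S \<in> cls p \<times> vbasis p then (if P = P' \<and> Q = Q' \<and> S = T then 1 else 0) else 0)"
    using assms by (simp add: sum.delta)
  finally show ?thesis by (cases "S \<in> cls p \<times> vbasis p") (simp_all del: mem_Sigma_iff)
qed

lemma unital_End_alg_imp_card: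
  fixes scale :: "'k::field \<Rightarrow> 'v::ab_group_add \<Rightarrow> 'v"
  assumes fin: "finite (cls p)" "finite (vbasis p)" and un: "unital G (End_alg G scale p)"
  shows "card (cls p \<times> vbasis p) = 1"
proof -
  define X where "X = cls p \<times> vbasis p"
  obtain \<eta> :: "unit \<Rightarrow> _ \<Rightarrow>\<^sub>0 'k" where
    mor: "crossed_morphism G (unit_crossed G) (End_alg G scale p) \<eta>" and
    \<Delta>: "(End_comult p \<bullet> \<eta>) () = (\<eta> \<boxtimes> \<eta>) ((), ())" and
    \<epsilon>: "(End_counit \<bullet> \<eta>) () = bas ()"
    using un unfolding unital_def by (auto simp only: End_alg_def braided_alg.simps)
  define u where "u = Poly_Mapping.lookup (\<eta> ())"
  have mult: "u (p', s) * u (t, q') = (if s = t then u (p', q') else 0)" if "s \<in> X" for p' s t q'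
  proof -
    have "u (p', s) * u (t, q') = Poly_Mapping.lookup (lin (End_comult p) (\<eta> ())) ((p', s), (t, q'))"
      using \<Delta> by (simp add: mcomp_def mtens_def lookup_tens u_def)
    also have "\<dots> = (\<Sum>x\<in>Poly_Mapping.keys (\<eta> ()). if x = (p', q') then (if s = t then u (p', q') else 0) else 0)"
      unfolding lookup_lin
    proof (rule sum.cong[OF refl])
      fix x :: "('a \<times> 'v) \<times> ('a \<times> 'v)"
      obtain P Q where "x = (P, Q)" by (cases x)
      then show "Poly_Mapping.lookup (\<eta> ()) x * Poly_Mapping.lookup (End_comult p x) ((p', s), (t, q')) =
          (if x = (p', q') then (if s = t then u (p', q') else 0) else 0)"
        using lookup_End_comult[OF fin, where ?'c = 'k, of P Q p' s t q'] that by (simp add: u_def X_def)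
    qed
    also have "\<dots> = (if s = t then u (p', q') else 0)"
      by (auto simp: sum.delta u_def in_keys_iff)
    finally show ?thesis .
  qed
  have "Poly_Mapping.lookup ((End_counit \<bullet> \<eta>) ()) () \<noteq> 0" using \<epsilon> by simp
  then obtain x where x: "x \<in> Poly_Mapping.keys (\<eta> ())"
    unfolding mcomp_def lookup_lin by (metis sum.not_neutral_contains_not_neutral)
  have "Poly_Mapping.keys (\<eta> ()) \<subseteq> basis (End_alg G scale p)"
    using mor unfolding crossed_morphism_def by (simp add: unit_crossed_def)
  then have "x \<in> X \<times> X" using x
    by (auto simp: End_alg_def End_cr_def tensor_crossed_def V_cr_def V_dual_cr_def X_def)
  then obtain a b where ab: "x = (a, b)" "a \<in> X" "b \<in> X" by auto
  have nz: "u (a, b) \<noteq> 0" using x ab by (simp add: u_def in_keys_iff)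
  have "t = b" if "t \<in> X" for t
  proof (rule ccontr)
    assume "t \<noteq> b"
    then have 0: "u (t, q') = 0" for q' using mult[of b a t q'] nz ab by simp
    have "u (a, t) * u (t, b) = u (a, b)" using mult[of t a t b] that by simp
    then show False using 0 nz by simp
  qed
  then have "X = {b}" using ab(3) by blast
  then show ?thesis by (simp add: X_def)
qed

end

theory Submission
  imports Defs
begin

text \<open>
  Let \<open>V\<close> be a finite-dimensional crossed module with homogeneous basis \<open>E\<^sub>u\<close>, and write
  \<open>A(h)\<close> for the matrices of the action.  For \<open>y\<close> homogeneous and \<open>b = |E\<^sub>v|\<close> put
  \<open>d = |b\<^sup>-\<^sup>1 \<triangleright> y| = b\<^sup>-\<^sup>1|y|b\<close>.  Since \<open>A(h)\<^sup>v\<^sub>u\<close> vanishes unless \<open>|E\<^sub>v| = h|E\<^sub>u|h\<^sup>-\<^sup>1\<close>,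
  the Kronecker delta in the bracket is absorbed into the matrix coefficient:
  \<open>[E\<^sub>u\<^sup>v, y] = A(d\<^sup>-\<^sup>1)\<^sup>v\<^sub>u b\<^sup>-\<^sup>1 \<triangleright> y\<close>, i.e. the bracket is \<open>\<epsilon>\<close> applied to the second leg of
  \<open>b\<^sup>-\<^sup>1 \<triangleright> y \<otimes> (d\<^sup>-\<^sup>1 \<triangleright> E\<^sub>u) \<otimes> E\<^sup>v\<close>, which is the fundamental braiding.  In this form \<open>y\<close> may
  lie in any other block, the axioms reduce to multiplicativity of \<open>A\<close>, and the inverse of
  the fundamental braiding is \<open>y \<otimes> E\<^sub>u\<^sup>v \<mapsto> (|y| \<triangleright> E\<^sub>u) \<otimes> E\<^sup>v \<otimes> b \<triangleright> y\<close>.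
\<close>

section \<open>Linear maps on free vector spaces\<close>

lemma lookup_scl: "Poly_Mapping.lookup (scl c v) x = c * Poly_Mapping.lookup v x"
  by (simp add: scl_def Poly_Mapping.map.rep_eq when_def)

lemma module_scl: "module (scl :: 'k::field \<Rightarrow> ('x \<Rightarrow>\<^sub>0 'k) \<Rightarrow> ('x \<Rightarrow>\<^sub>0 'k))"
  by standard (auto intro!: poly_mapping_eqI simp: lookup_scl lookup_add algebra_simps)

interpretation scl: module scl by (rule module_scl)

lemma single_eq_scl: "Poly_Mapping.single x c = scl c (bas x)"
  by (rule poly_mapping_eqI) (simp add: lookup_scl lookup_single when_def)

lemma keys_scl: "Poly_Mapping.keys (scl c v) \<subseteq> Poly_Mapping.keys v"
  by (auto simp: in_keys_iff lookup_scl)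

lemma module_hom_sclI:
  assumes "\<And>v w. F (v + w) = F v + F w" "\<And>c v. F (scl c v) = scl c (F v)"
  shows "module_hom scl scl F"
  using assms by (simp add: module_hom_iff module_scl)

lemma lin_on:
  assumes "finite S" "Poly_Mapping.keys v \<subseteq> S"
  shows "lin f v = (\<Sum>x\<in>S. scl (Poly_Mapping.lookup v x) (f x))"
  unfolding lin_def using assms
  by (intro sum.mono_neutral_left) (auto simp: in_keys_iff)

lemma module_hom_lin:
  fixes f :: "'x \<Rightarrow> ('y \<Rightarrow>\<^sub>0 'k::field)"
  shows "module_hom scl scl (lin f)"
proof (rule module_hom_sclI)
  fix v w :: "'x \<Rightarrow>\<^sub>0 'k"
  let ?S = "Poly_Mapping.keys v \<union> Poly_Mapping.keys w"
  have *: "finite ?S" by simp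
  have "Poly_Mapping.keys (v + w) \<subseteq> ?S" by (rule Poly_Mapping.keys_add)
  then show "lin f (v + w) = lin f v + lin f w"
    by (simp add: lin_on[OF *] lookup_add scl.scale_left_distrib sum.distrib)
next
  fix c and v :: "'x \<Rightarrow>\<^sub>0 'k"
  show "lin f (scl c v) = scl c (lin f v)"
    unfolding lin_on[OF finite_keys keys_scl[of c v]]
    by (simp add: lookup_scl scl.scale_sum_right lin_def)
qed

lemmas lin_scl = module_hom.scale[OF module_hom_lin]
  and lin_sum = module_hom.sum[OF module_hom_lin]
  and lin_zero [simp] = module_hom.zero[OF module_hom_lin]

lemma lin_single: "lin f (Poly_Mapping.single x c) = scl c (f x)"
  by (cases "c = 0") (simp_all add: lin_def)

lemma lin_bas [simp]: "lin f (bas x) = f x"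
  by (simp add: lin_single)

lemma expand_bas: "v = (\<Sum>x\<in>Poly_Mapping.keys v. scl (Poly_Mapping.lookup v x) (bas x))"
  by (rule poly_mapping_eqI) (simp add: lookup_sum lookup_scl lookup_single when_def in_keys_iff if_distrib cong: if_cong)

text \<open>Agreement is demanded only on the support of \<open>v\<close>, so facts known only for
  basis elements of one block or one degree can be used pointwise; \<open>bilinear_ext\<close> and
  \<open>trilinear_ext\<close> iterate this.\<close>

lemma hom_ext:
  assumes "module_hom scl scl F" "module_hom scl scl F'"
    and "\<And>x. x \<in> Poly_Mapping.keys v \<Longrightarrow> F (bas x) = F' (bas x)"
  shows "F v = F' v"
  by (subst (1 2) expand_bas)
     (simp add: module_hom.sum[OF assms(1)] module_hom.sum[OF assms(2)]
        module_hom.scale[OF assms(1)] module_hom.scale[OF assms(2)] assms(3))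

lemma module_hom_tens_left: "module_hom scl scl (\<lambda>v. tens v w)"
  by (rule module_hom_sclI; rule poly_mapping_eqI)
     (auto simp: lookup_tens lookup_add lookup_scl algebra_simps)

lemma module_hom_tens_right: "module_hom scl scl (tens v)"
  by (rule module_hom_sclI; rule poly_mapping_eqI)
     (auto simp: lookup_tens lookup_add lookup_scl algebra_simps)

lemmas tens_sum_left = module_hom.sum[OF module_hom_tens_left]
  and tens_scl_left = module_hom.scale[OF module_hom_tens_left]
  and tens_sum_right = module_hom.sum[OF module_hom_tens_right]
  and tens_scl_right = module_hom.scale[OF module_hom_tens_right]

lemma tens_bas [simp]: "tens (bas x) (bas y) = bas (x, y)"
  by (simp add: tens_def)

lemma lin_tens_bas [simp]: "lin f (tens (bas x) (bas y)) = f (x, y)"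
  by simp

lemma keys_tens: "Poly_Mapping.keys (tens v w) = Poly_Mapping.keys v \<times> Poly_Mapping.keys w"
  by (auto simp: in_keys_iff lookup_tens)

lemma keys_lin: "Poly_Mapping.keys (lin f v) \<subseteq> (\<Union>x\<in>Poly_Mapping.keys v. Poly_Mapping.keys (f x))"
proof
  fix y assume "y \<in> Poly_Mapping.keys (lin f v)"
  then obtain x where "x \<in> Poly_Mapping.keys v" "Poly_Mapping.lookup (f x) y \<noteq> 0"
    by (auto simp: in_keys_iff lookup_lin elim!: sum.not_neutral_contains_not_neutral)
  then show "y \<in> (\<Union>x\<in>Poly_Mapping.keys v. Poly_Mapping.keys (f x))" by (auto simp: in_keys_iff)
qed

lemma hom_comp:
  assumes "module_hom scl scl F" "module_hom scl scl H"
  shows "module_hom scl scl (\<lambda>v. F (H v))"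
  using module_hom_compose[OF assms(2,1)] by (simp add: o_def)

lemma hom_scl: "module_hom scl scl F \<Longrightarrow> module_hom scl scl (\<lambda>v. scl c (F v))"
  by (simp add: module_hom_iff scl.scale_right_distrib mult.commute)

lemma hom_sum:
  "(\<And>i. i \<in> S \<Longrightarrow> module_hom scl scl (F i)) \<Longrightarrow> module_hom scl scl (\<lambda>v. \<Sum>i\<in>S. F i v)"
  by (simp add: module_hom_iff sum.distrib scl.scale_sum_right module_scl)

lemmas hom_intros = module_hom_lin module_hom_tens_left module_hom_tens_right scl.module_hom_ident
  hom_comp[OF module_hom_lin] hom_comp[OF module_hom_tens_left]
  hom_comp[OF module_hom_tens_right] hom_scl

lemma lin_cong: "(\<And>x. x \<in> Poly_Mapping.keys v \<Longrightarrow> f x = f' x) \<Longrightarrow> lin f v = lin f' v"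
  by (simp add: lin_def)

lemma lin_lin: "lin f (lin g v) = lin (\<lambda>x. lin f (g x)) v"
  by (rule hom_ext[of "\<lambda>v. lin f (lin g v)"]) (auto intro: hom_intros)

lemma lin_idm [simp]: "lin idm v = v"
  by (rule hom_ext[of "lin idm"]) (auto intro: hom_intros)

lemma lin_unit [simp]: "lin (\<lambda>_. bas ()) v = v"
proof -
  have "lin (\<lambda>_. bas ()) v = lin idm v" by (rule lin_cong) simp
  then show ?thesis by (simp only: lin_idm)
qed

lemma bilinear_ext:
  assumes "\<And>w. module_hom scl scl (\<lambda>v. F v w)" "\<And>v. module_hom scl scl (F v)"
    and "\<And>w. module_hom scl scl (\<lambda>v. F' v w)" "\<And>v. module_hom scl scl (F' v)"
    and "\<And>x y. x \<in> Poly_Mapping.keys v \<Longrightarrow> y \<in> Poly_Mapping.keys w \<Longrightarrow>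
      F (bas x) (bas y) = F' (bas x) (bas y)"
  shows "F v w = F' v w"
proof (rule hom_ext[OF assms(1,3)])
  show "F (bas x) w = F' (bas x) w" if "x \<in> Poly_Mapping.keys v" for x
    by (rule hom_ext[OF assms(2,4)]) (rule assms(5)[OF that])
qed

lemma trilinear_ext:
  assumes "\<And>v w. module_hom scl scl (\<lambda>u. F u v w)" "\<And>u w. module_hom scl scl (\<lambda>v. F u v w)"
    and "\<And>u v. module_hom scl scl (F u v)"
    and "\<And>v w. module_hom scl scl (\<lambda>u. F' u v w)" "\<And>u w. module_hom scl scl (\<lambda>v. F' u v w)"
    and "\<And>u v. module_hom scl scl (F' u v)"
    and "\<And>x y z. x \<in> Poly_Mapping.keys u \<Longrightarrow> y \<in> Poly_Mapping.keys v \<Longrightarrow> z \<in> Poly_Mapping.keys w \<Longrightarrow>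
      F (bas x) (bas y) (bas z) = F' (bas x) (bas y) (bas z)"
  shows "F u v w = F' u v w"
proof (rule hom_ext[OF assms(1,4)])
  show "F (bas x) v w = F' (bas x) v w" if "x \<in> Poly_Mapping.keys u" for x
    by (rule bilinear_ext[OF assms(2,3,5,6)]) (rule assms(7)[OF that])
qed

lemma lin_mtens [simp]: "lin (f \<boxtimes> g) (tens v w) = tens (lin f v) (lin g w)"
  by (rule bilinear_ext[of "\<lambda>v w. lin (f \<boxtimes> g) (tens v w)"])
     (auto intro!: hom_intros simp: mtens_def)

lemma mtens_apply [simp]: "(f \<boxtimes> g) (x, y) = tens (f x) (g y)"
  by (simp add: mtens_def)

lemma lin_mcomp: "lin (f \<bullet> g) v = lin f (lin g v)"
  by (simp add: lin_lin mcomp_def [abs_def])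

lemma lin_assoc_r [simp]: "lin assoc_r (tens (tens a b) c) = tens a (tens b c)"
  by (rule trilinear_ext[of "\<lambda>a b c. lin assoc_r (tens (tens a b) c)"])
     (auto intro!: hom_intros simp: assoc_r_def)

lemma lin_assoc_l [simp]: "lin assoc_l (tens a (tens b c)) = tens (tens a b) c"
  by (rule trilinear_ext[of "\<lambda>a b c. lin assoc_l (tens a (tens b c))"])
     (auto intro!: hom_intros simp: assoc_l_def)

text \<open>Values that are pure tensors are enough here: the braiding sends a pair of basis
  elements to such a tensor.\<close>

lemma mid_eq:
  assumes "f (y, z) = tens a b"
  shows "mid f ((x, y), (z, w)) = tens (tens (bas x) a) (tens b (bas w))"
proof -
  have "mid f ((x, y), (z, w)) = lin (mid f) (tens (tens (bas x) (bas y)) (tens (bas z) (bas w)))"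
    by simp
  also have "\<dots> = tens (tens (bas x) a) (tens b (bas w))"
    unfolding mid_def lin_mcomp lin_assoc_r lin_mtens lin_assoc_l by (simp add: assms)
  finally show ?thesis .
qed

section \<open>Homogeneous vectors and their degrees\<close>

definition homog :: "'x set \<Rightarrow> ('x \<Rightarrow> 'g) \<Rightarrow> ('x \<Rightarrow>\<^sub>0 'k::field) \<Rightarrow> 'g \<Rightarrow> bool" where
  "homog B d v g \<longleftrightarrow> (\<forall>x\<in>Poly_Mapping.keys v. x \<in> B \<and> d x = g)"

lemma homog_bas: "x \<in> B \<Longrightarrow> homog B d (bas x) (d x)"
  by (simp add: homog_def)

lemma homog_scl: "homog B d v g \<Longrightarrow> homog B d (scl c v) g"
  using keys_scl by (fastforce simp: homog_def)

lemma homog_sum: "(\<And>i. i \<in> S \<Longrightarrow> homog B d (f i) g) \<Longrightarrow> homog B d (sum f S) g"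
  using keys_sum[of f S] by (fastforce simp: homog_def)

lemma homog_lin:
  assumes "homog B d v g" "\<And>x. x \<in> B \<Longrightarrow> d x = g \<Longrightarrow> homog B' d' (f x) g'"
  shows "homog B' d' (lin f v) g'"
  using assms keys_lin[of f v] by (fastforce simp: homog_def)

text \<open>The zero vector is \<open>homog\<close> of every degree, so only a nonzero vector
  determines its degree.\<close>

lemma hdeg_homog: "homog (basis M) (bdeg M) v g \<Longrightarrow> v \<noteq> 0 \<Longrightarrow> hdeg M v = g"
  unfolding hdeg_def homog_def
  by (rule the_equality) (simp, metis keys_eq_empty all_not_in_conv)

lemma crossed_module_homog:
  assumes "crossed_module G M" "h \<in> carrier G" "x \<in> basis M"
  shows "homog (basis M) (bdeg M) (act M h x) (h \<otimes>\<^bsub>G\<^esub> bdeg M x \<otimes>\<^bsub>G\<^esub> inv\<^bsub>G\<^esub> h)"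
  using assms unfolding crossed_module_def homog_def by blast

text \<open>Acting with the inverse of \<open>h\<close> recovers \<open>bas x\<close>, so
  \<open>act M h x\<close> is nonzero and its degree well defined. This evaluates the degree test
  hidden in \<open>End_bracket\<close>.\<close>

lemma crossed_module_hdeg:
  assumes "group G" "crossed_module G M" "h \<in> carrier G" "x \<in> basis M"
  shows "hdeg M (act M h x) = h \<otimes>\<^bsub>G\<^esub> bdeg M x \<otimes>\<^bsub>G\<^esub> inv\<^bsub>G\<^esub> h"
proof (rule hdeg_homog[OF crossed_module_homog[OF assms(2-)]])
  interpret group G by fact
  have "lin (act M (inv\<^bsub>G\<^esub> h)) (act M h x) = act M (inv\<^bsub>G\<^esub> h \<otimes>\<^bsub>G\<^esub> h) x"
    using assms unfolding crossed_module_def by (metis inv_closed)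
  also have "\<dots> = bas x" using assms by (simp add: crossed_module_def)
  finally show "act M h x \<noteq> 0"
    by (metis lin_zero keys_single keys_zero insert_not_empty zero_neq_one)
qed

lemma crossed_morphism_iff_homog:
  "crossed_morphism G M N f \<longleftrightarrow>
     (\<forall>x\<in>basis M. homog (basis N) (bdeg N) (f x) (bdeg M x)) \<and>
     (\<forall>h\<in>carrier G. \<forall>x\<in>basis M. lin f (act M h x) = lin (act N h) (f x))"
  by (auto simp: crossed_morphism_def homog_def)

text \<open>In a product bracketed to the right, \<open>l_inv\<close> and \<open>r_inv\<close> match
  only at the end of the word. These two rules cancel inverse pairs further inside, so that
  \<open>group_norm\<close> brings group words to normal form.\<close>

lemma (in group) cancel_left:
  assumes "x \<in> carrier G" "y \<in> carrier G"
  shows "x \<otimes> (inv x \<otimes> y) = y" "inv x \<otimes> (x \<otimes> y) = y"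
  using assms by (simp_all flip: m_assoc)

lemmas (in group) group_norm = m_assoc inv_mult_group cancel_left

section \<open>Direct sums of matrix blocks\<close>

text \<open>
  The blocks are indexed by \<open>s \<in> I\<close>; the parameter \<open>E\<close> embeds the matrix units of the blocks
  into the basis of \<open>L\<close>, so that a single block and a direct sum are both instances.
\<close>

locale block_crossed = group G for G :: "('g, 'a) monoid_scheme" (structure) +
  fixes I :: "'i set" and X :: "'i \<Rightarrow> 'x set" and dg :: "'i \<Rightarrow> 'x \<Rightarrow> 'g"
    and A :: "'i \<Rightarrow> 'g \<Rightarrow> 'x \<Rightarrow> 'x \<Rightarrow> 'k::field"
    and E :: "'i \<Rightarrow> 'x \<Rightarrow> 'x \<Rightarrow> 'b"
    and L :: "('b, 'g, 'k, 'z) crossed_scheme"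
  assumes finite_X: "s \<in> I \<Longrightarrow> finite (X s)"
    and dg_closed: "s \<in> I \<Longrightarrow> u \<in> X s \<Longrightarrow> dg s u \<in> carrier G"
    and A_one: "s \<in> I \<Longrightarrow> u \<in> X s \<Longrightarrow> v \<in> X s \<Longrightarrow> A s \<one> v u = (if v = u then 1 else 0)"
    and A_mult: "s \<in> I \<Longrightarrow> u \<in> X s \<Longrightarrow> w \<in> X s \<Longrightarrow> g \<in> carrier G \<Longrightarrow> h \<in> carrier G \<Longrightarrow>
      A s (g \<otimes> h) w u = (\<Sum>v\<in>X s. A s g w v * A s h v u)"
    and A_dg: "s \<in> I \<Longrightarrow> u \<in> X s \<Longrightarrow> v \<in> X s \<Longrightarrow> h \<in> carrier G \<Longrightarrow> A s h v u \<noteq> 0 \<Longrightarrow>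
      dg s v = h \<otimes> dg s u \<otimes> inv h"
    and E_inj: "inj_on (\<lambda>(s, u, v). E s u v) (SIGMA s:I. X s \<times> X s)"
    and basis_L: "basis L = {E s u v | s u v. s \<in> I \<and> u \<in> X s \<and> v \<in> X s}"
    and bdeg_L: "s \<in> I \<Longrightarrow> u \<in> X s \<Longrightarrow> v \<in> X s \<Longrightarrow> bdeg L (E s u v) = dg s u \<otimes> inv (dg s v)"
    and act_L: "s \<in> I \<Longrightarrow> u \<in> X s \<Longrightarrow> v \<in> X s \<Longrightarrow> h \<in> carrier G \<Longrightarrow> act L h (E s u v) =
      (\<Sum>u'\<in>X s. \<Sum>v'\<in>X s. Poly_Mapping.single (E s u' v') (A s h u' u * A s (inv h) v v'))"
begin

section \<open>The action on vectors, dual vectors and matrix units\<close>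

definition act_vec :: "'i \<Rightarrow> 'g \<Rightarrow> 'x \<Rightarrow> ('x \<Rightarrow>\<^sub>0 'k)" where
  "act_vec s h u = (\<Sum>u'\<in>X s. Poly_Mapping.single u' (A s h u' u))"

text \<open>The contragredient action: the matrix of \<open>inv h\<close> is transposed, the index
  \<open>v\<close> being its row.\<close>

definition act_dual :: "'i \<Rightarrow> 'g \<Rightarrow> 'x \<Rightarrow> ('x \<Rightarrow>\<^sub>0 'k)" where
  "act_dual s h v = (\<Sum>v'\<in>X s. Poly_Mapping.single v' (A s (inv h) v v'))"

text \<open>The rank-one operator \<open>a \<otimes> b\<close> of block \<open>s\<close>. The group
  action and the fundamental braiding are computed in this form, one tensor leg at a time.\<close>

definition ee :: "'i \<Rightarrow> ('x \<Rightarrow>\<^sub>0 'k) \<Rightarrow> ('x \<Rightarrow>\<^sub>0 'k) \<Rightarrow> ('b \<Rightarrow>\<^sub>0 'k)" where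
  "ee s a b = lin (\<lambda>(u, v). bas (E s u v)) (tens a b)"

lemma ee_bas [simp]: "ee s (bas u) (bas v) = bas (E s u v)"
  by (simp add: ee_def)

lemma hom_ee_left: "module_hom scl scl (\<lambda>a. ee s a b)"
  and hom_ee_right: "module_hom scl scl (ee s a)"
  unfolding ee_def [abs_def] by (intro hom_intros)+

lemmas hom_ee = hom_ee_left hom_ee_right hom_comp[OF hom_ee_left] hom_comp[OF hom_ee_right]

lemma basis_E [intro]: "s \<in> I \<Longrightarrow> u \<in> X s \<Longrightarrow> v \<in> X s \<Longrightarrow> E s u v \<in> basis L"
  by (auto simp: basis_L)

lemma basis_cases:
  assumes "x \<in> basis L"
  obtains s u v where "s \<in> I" "u \<in> X s" "v \<in> X s" "x = E s u v"
  using assms by (auto simp: basis_L)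

lemma bdeg_closed [simp]: "x \<in> basis L \<Longrightarrow> bdeg L x \<in> carrier G"
  by (elim basis_cases) (simp add: bdeg_L dg_closed)

lemma keys_act_vec: "Poly_Mapping.keys (act_vec s h u) \<subseteq> X s"
  and keys_act_dual: "Poly_Mapping.keys (act_dual s h u) \<subseteq> X s"
  unfolding act_vec_def act_dual_def
  by (rule order.trans[OF keys_sum], fastforce split: if_splits)+

lemma act_E:
  assumes "s \<in> I" "u \<in> X s" "v \<in> X s" "h \<in> carrier G"
  shows "act L h (E s u v) = ee s (act_vec s h u) (act_dual s h v)"
  unfolding act_L[OF assms] act_vec_def act_dual_def module_hom.sum[OF hom_ee_left]
  by (intro sum.cong refl, unfold module_hom.sum[OF hom_ee_right], intro sum.cong refl,
      subst (1 2 3) single_eq_scl)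
     (simp add: module_hom.scale[OF hom_ee_left] module_hom.scale[OF hom_ee_right] mult.commute)

lemma act_vec_one: "s \<in> I \<Longrightarrow> u \<in> X s \<Longrightarrow> act_vec s \<one> u = bas u"
  and act_dual_one: "s \<in> I \<Longrightarrow> u \<in> X s \<Longrightarrow> act_dual s \<one> u = bas u"
  by (auto intro!: poly_mapping_eqI
      simp: act_vec_def act_dual_def A_one lookup_sum lookup_single when_def finite_X
      sum.delta if_distrib cong: if_cong)

lemma lookup_act_vec:
  "s \<in> I \<Longrightarrow> Poly_Mapping.lookup (act_vec s h u) w = (if w \<in> X s then A s h w u else 0)"
  by (simp add: act_vec_def lookup_sum lookup_single when_def finite_X)

lemma lookup_act_dual:
  "s \<in> I \<Longrightarrow> Poly_Mapping.lookup (act_dual s h u) w = (if w \<in> X s then A s (inv h) u w else 0)"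
  by (simp add: act_dual_def lookup_sum lookup_single when_def finite_X)

lemma lookup_lin_on:
  "finite S \<Longrightarrow> Poly_Mapping.keys v \<subseteq> S \<Longrightarrow>
   Poly_Mapping.lookup (lin f v) y = (\<Sum>x\<in>S. Poly_Mapping.lookup v x * Poly_Mapping.lookup (f x) y)"
  by (simp add: lin_on lookup_sum lookup_scl)

lemma act_vec_mult:
  assumes "s \<in> I" "u \<in> X s" "g \<in> carrier G" "h \<in> carrier G"
  shows "lin (act_vec s g) (act_vec s h u) = act_vec s (g \<otimes> h) u"
  by (rule poly_mapping_eqI)
     (simp add: assms lookup_lin_on[OF finite_X keys_act_vec] lookup_act_vec A_mult mult.commute)

text \<open>Inversion and transposition each reverse the order of a product; together they restore
  it.\<close>

lemma act_dual_mult: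
  assumes "s \<in> I" "u \<in> X s" "g \<in> carrier G" "h \<in> carrier G"
  shows "lin (act_dual s g) (act_dual s h u) = act_dual s (g \<otimes> h) u"
  by (rule poly_mapping_eqI)
     (simp add: assms lookup_lin_on[OF finite_X keys_act_dual] lookup_act_dual A_mult inv_mult_group)

lemma homog_act_vec:
  "s \<in> I \<Longrightarrow> u \<in> X s \<Longrightarrow> h \<in> carrier G \<Longrightarrow>
    homog (X s) (dg s) (act_vec s h u) (h \<otimes> dg s u \<otimes> inv h)"
  using A_dg by (auto simp: homog_def in_keys_iff lookup_act_vec split: if_splits)

lemma homog_act_dual:
  assumes "s \<in> I" "u \<in> X s" "h \<in> carrier G"
  shows "homog (X s) (dg s) (act_dual s h u) (h \<otimes> dg s u \<otimes> inv h)"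
  unfolding homog_def
proof (intro ballI conjI)
  fix v assume v: "v \<in> Poly_Mapping.keys (act_dual s h u)"
  then show "v \<in> X s" using keys_act_dual by blast
  \<comment> \<open>A nonzero coefficient here is the entry of \<open>inv h\<close> in row
    \<open>u\<close> and column \<open>v\<close>, so \<open>A_dg\<close> yields the degree of
    \<open>u\<close> from that of \<open>v\<close>; solving for \<open>dg s v\<close> gives the
    claim.\<close>
  then have "dg s u = inv h \<otimes> dg s v \<otimes> inv (inv h)"
    using v assms by (intro A_dg) (auto simp: in_keys_iff lookup_act_dual)
  then show "dg s v = h \<otimes> dg s u \<otimes> inv h"
    using assms \<open>v \<in> X s\<close> by (simp add: group_norm dg_closed)
qed

text \<open>Degrees of dual vectors are measured by \<open>dg s\<close>, that is, by the vectors
  they are dual to; hence the second factor enters inverted.\<close>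

lemma homog_ee:
  assumes "s \<in> I" "homog (X s) (dg s) a g" "homog (X s) (dg s) b h"
  shows "homog (basis L) (bdeg L) (ee s a b) (g \<otimes> inv h)"
  unfolding ee_def
  by (rule homog_lin[of "X s \<times> X s" "\<lambda>(u, v). dg s u \<otimes> inv (dg s v)"])
     (use assms in \<open>auto simp: homog_def keys_tens bdeg_L\<close>)

lemma lin_act_ee:
  assumes "s \<in> I" "Poly_Mapping.keys a \<subseteq> X s" "Poly_Mapping.keys b \<subseteq> X s" "h \<in> carrier G"
  shows "lin (act L h) (ee s a b) = ee s (lin (act_vec s h) a) (lin (act_dual s h) b)"
  by (rule bilinear_ext[of "\<lambda>a b. lin (act L h) (ee s a b)"])
     (use assms in \<open>auto intro!: hom_intros hom_ee simp: act_E subsetD\<close>)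

lemma act_one: "x \<in> basis L \<Longrightarrow> act L \<one> x = bas x"
  by (elim basis_cases) (simp add: act_E act_vec_one act_dual_one)

lemma act_act:
  assumes "x \<in> basis L" "g \<in> carrier G" "h \<in> carrier G"
  shows "lin (act L g) (act L h x) = act L (g \<otimes> h) x"
  using assms(1)
  by (rule basis_cases)
     (simp add: act_E lin_act_ee keys_act_vec keys_act_dual act_vec_mult act_dual_mult assms)

lemma homog_act:
  assumes "x \<in> basis L" "h \<in> carrier G"
  shows "homog (basis L) (bdeg L) (act L h x) (h \<otimes> bdeg L x \<otimes> inv h)"
proof -
  obtain s u v where x: "s \<in> I" "u \<in> X s" "v \<in> X s" "x = E s u v"
    using assms(1) by (rule basis_cases)
  show ?thesis
    using homog_ee[OF x(1) homog_act_vec homog_act_dual, OF x(1,2) assms(2) x(1,3) assms(2)] x assms(2)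
    by (simp add: act_E bdeg_L group_norm dg_closed)
qed

lemma crossed_module_L: "crossed_module G L"
  unfolding crossed_module_def
  using homog_act by (auto simp: act_one act_act homog_def)

end

text \<open>The bracket is required in the form without a Kronecker delta. Its exponent is the
  inverse of the degree of \<open>act L (inv (dg s v)) y\<close>, and \<open>y\<close> may come from
  any block.\<close>

locale block_braided = block_crossed G I X dg A E L
  for G :: "('g, 'a) monoid_scheme" (structure) and I :: "'i set" and X :: "'i \<Rightarrow> 'x set"
    and dg :: "'i \<Rightarrow> 'x \<Rightarrow> 'g" and A :: "'i \<Rightarrow> 'g \<Rightarrow> 'x \<Rightarrow> 'x \<Rightarrow> 'k::field"
    and E :: "'i \<Rightarrow> 'x \<Rightarrow> 'x \<Rightarrow> 'b" and L :: "('b, 'g, 'k, 'z) braided_alg_scheme" +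
  assumes comult_L: "s \<in> I \<Longrightarrow> u \<in> X s \<Longrightarrow> v \<in> X s \<Longrightarrow>
      comult L (E s u v) = (\<Sum>c\<in>X s. bas (E s u c, E s c v))"
    and counit_L: "s \<in> I \<Longrightarrow> u \<in> X s \<Longrightarrow> v \<in> X s \<Longrightarrow>
      counit L (E s u v) = Poly_Mapping.single () (if u = v then 1 else 0)"
    and bracket_L: "s \<in> I \<Longrightarrow> u \<in> X s \<Longrightarrow> v \<in> X s \<Longrightarrow> y \<in> basis L \<Longrightarrow>
      bracket L (E s u v, y) =
        scl (A s (inv (dg s v) \<otimes> inv (bdeg L y) \<otimes> dg s v) v u) (act L (inv (dg s v)) y)"
begin

text \<open>Evaluation of the dual vector \<open>b\<close> on the vector \<open>a\<close> after
  \<open>h\<close> has acted on it. At \<open>h = \<one>\<close> this is the counit on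
  \<open>ee s a b\<close>, in general the coefficient of the bracket.\<close>

definition pairing :: "'i \<Rightarrow> 'g \<Rightarrow> ('x \<Rightarrow>\<^sub>0 'k) \<Rightarrow> ('x \<Rightarrow>\<^sub>0 'k) \<Rightarrow> 'k" where
  "pairing s h a b =
     (\<Sum>u\<in>X s. \<Sum>v\<in>X s. Poly_Mapping.lookup a u * Poly_Mapping.lookup b v * A s h v u)"

lemma hom_pairing_left: "module_hom scl scl (\<lambda>a. scl (pairing s h a b) w)"
  and hom_pairing_right: "module_hom scl scl (\<lambda>b. scl (pairing s h a b) w)"
  by (rule module_hom_sclI;
      simp add: pairing_def lookup_add lookup_scl algebra_simps sum.distrib sum_distrib_left
        flip: scl.scale_left_distrib)+

lemma pairing_bas [simp]: "s \<in> I \<Longrightarrow> u \<in> X s \<Longrightarrow> v \<in> X s \<Longrightarrow> pairing s h (bas u) (bas v) = A s h v u"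
proof -
  assume s: "s \<in> I" "u \<in> X s" "v \<in> X s"
  have "pairing s h (bas u) (bas v) =
      (\<Sum>u'\<in>X s. if u = u' then (\<Sum>v'\<in>X s. if v = v' then A s h v u else 0) else 0)"
    unfolding pairing_def by (intro sum.cong refl) (auto simp: lookup_single when_def intro!: sum.cong)
  then show ?thesis using s by (simp add: finite_X)
qed

text \<open>The dual action contributes \<open>inv h\<close> on the left and the vector action
  \<open>h\<close> on the right of \<open>k\<close>, so two applications of \<open>A_mult\<close>
  give the conjugate. For \<open>k = \<one>\<close> this is invariance of the counit.\<close>

lemma pairing_act:
  assumes "s \<in> I" "u \<in> X s" "v \<in> X s" "h \<in> carrier G" "k \<in> carrier G"
  shows "pairing s k (act_vec s h u) (act_dual s h v) = A s (inv h \<otimes> k \<otimes> h) v u"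
proof -
  have "pairing s k (act_vec s h u) (act_dual s h v) =
      (\<Sum>u'\<in>X s. (\<Sum>v'\<in>X s. A s (inv h) v v' * A s k v' u') * A s h u' u)"
    by (simp add: pairing_def lookup_act_vec lookup_act_dual assms sum_distrib_right sum_distrib_left ac_simps)
  also have "\<dots> = (\<Sum>u'\<in>X s. A s (inv h \<otimes> k) v u' * A s h u' u)"
    using assms by (intro sum.cong refl) (simp add: A_mult)
  also have "\<dots> = A s (inv h \<otimes> k \<otimes> h) v u"
    using assms by (simp add: A_mult)
  finally show ?thesis .
qed

text \<open>The group elements in \<open>bracket_L\<close> depend on the degrees of \<open>v\<close>
  and \<open>y\<close>, so the formula extends linearly only to homogeneous \<open>b\<close> and
  \<open>w\<close>.\<close>

lemma lin_bracket_ee: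
  assumes "s \<in> I" "Poly_Mapping.keys a \<subseteq> X s" "homog (X s) (dg s) b g"
    and "homog (basis L) (bdeg L) w m"
  shows "lin (bracket L) (tens (ee s a b) w) =
    scl (pairing s (inv g \<otimes> inv m \<otimes> g) a b) (lin (act L (inv g)) w)"
  by (rule trilinear_ext[of "\<lambda>a b w. lin (bracket L) (tens (ee s a b) w)"
        "\<lambda>a b w. scl (pairing s (inv g \<otimes> inv m \<otimes> g) a b) (lin (act L (inv g)) w)"])
     (use assms in \<open>auto intro!: hom_intros hom_ee hom_comp[OF module_hom_lin hom_comp[OF module_hom_tens_left hom_ee_left]]
        hom_comp[OF module_hom_lin hom_comp[OF module_hom_tens_left hom_ee_right]]
        hom_pairing_left hom_pairing_right simp: bracket_L homog_def subsetD\<close>)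

lemma lin_bracket_E:
  assumes "s \<in> I" "u \<in> X s" "v \<in> X s" "homog (basis L) (bdeg L) w m"
  shows "lin (bracket L) (tens (bas (E s u v)) w) =
    scl (A s (inv (dg s v) \<otimes> inv m \<otimes> dg s v) v u) (lin (act L (inv (dg s v))) w)"
  using lin_bracket_ee[OF assms(1) _ homog_bas[where d = "dg s", OF assms(3)] assms(4), of "bas u"]
    assms(1-3) by simp

lemma lin_bracket_E_act:
  assumes "s \<in> I" "u \<in> X s" "v \<in> X s" "y \<in> basis L" "h \<in> carrier G"
  shows "lin (bracket L) (tens (bas (E s u v)) (act L h y)) =
    scl (A s (inv (dg s v) \<otimes> h \<otimes> inv (bdeg L y) \<otimes> inv h \<otimes> dg s v) v u) (act L (inv (dg s v) \<otimes> h) y)"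
  using assms by (simp add: lin_bracket_E[OF _ _ _ homog_act] act_act dg_closed group_norm)

lemma lin_comult_ee:
  assumes "s \<in> I" "Poly_Mapping.keys a \<subseteq> X s" "Poly_Mapping.keys b \<subseteq> X s"
  shows "lin (comult L) (ee s a b) = (\<Sum>c\<in>X s. tens (ee s a (bas c)) (ee s (bas c) b))"
  by (rule bilinear_ext[of "\<lambda>a b. lin (comult L) (ee s a b)"])
     (use assms in \<open>auto intro!: hom_intros hom_ee hom_sum
        hom_comp[OF module_hom_tens_left hom_ee_left] hom_comp[OF module_hom_tens_right hom_ee_right]
        simp: comult_L subsetD\<close>)

lemma lin_counit_ee:
  assumes "s \<in> I" "Poly_Mapping.keys a \<subseteq> X s" "Poly_Mapping.keys b \<subseteq> X s"
  shows "lin (counit L) (ee s a b) = scl (pairing s \<one> a b) (bas ())"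
  by (rule bilinear_ext[of "\<lambda>a b. lin (counit L) (ee s a b)" "\<lambda>a b. scl (pairing s \<one> a b) (bas ())"])
     (use assms in \<open>auto intro!: hom_intros hom_ee hom_pairing_left hom_pairing_right
        simp: counit_L A_one subsetD\<close>)

section \<open>The braiding and the closed form of the fundamental braiding\<close>

lemma braiding_L [simp]: "braiding L L (x, y) = tens (act L (bdeg L x) y) (bas x)"
  by (simp add: braiding_def)

lemma lin_braiding:
  assumes "homog (basis L) (bdeg L) w m"
  shows "lin (braiding L L) (tens w t) = tens (lin (act L m) t) w"
  by (rule bilinear_ext[of "\<lambda>w t. lin (braiding L L) (tens w t)"])
     (use assms in \<open>auto intro!: hom_intros simp: homog_def\<close>)

text \<open>The coproduct splits the operator at an index \<open>c\<close>. The braiding acts on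
  \<open>y\<close> with \<open>dg s c \<otimes> inv (dg s v)\<close> and the bracket then with
  \<open>inv (dg s c)\<close>, so the first leg does not depend on \<open>c\<close>; the
  coefficients that remain sum up to an action on \<open>u\<close>.\<close>

lemma fund_braiding_E:
  assumes "s \<in> I" "u \<in> X s" "v \<in> X s" "y \<in> basis L"
  shows "fund_braiding L (E s u v, y) =
    tens (act L (inv (dg s v)) y)
      (ee s (act_vec s (inv (dg s v) \<otimes> inv (bdeg L y) \<otimes> dg s v) u) (bas v))"
proof -
  let ?k = "inv (dg s v) \<otimes> inv (bdeg L y) \<otimes> dg s v"
  note [simp] = dg_closed[OF assms(1)] assms
  have "fund_braiding L (E s u v, y) = (\<Sum>c\<in>X s. 
      tens (lin (bracket L) (tens (bas (E s u c)) (act L (dg s c \<otimes> inv (dg s v)) y))) (bas (E s c v)))"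
    by (simp add: fund_braiding_def mcomp_def comult_L tens_sum_left lin_sum bdeg_L flip: tens_bas)
  \<comment> \<open>The degree of \<open>c\<close> cancels both in the group element acting on
    \<open>y\<close> and in the exponent of \<open>A\<close>.\<close>
  also have "\<dots> = (\<Sum>c\<in>X s. scl (A s ?k c u) (tens (act L (inv (dg s v)) y) (bas (E s c v))))"
    by (intro sum.cong refl) (simp add: lin_bracket_E_act group_norm tens_scl_left)
  also have "\<dots> = tens (act L (inv (dg s v)) y) (ee s (act_vec s ?k u) (bas v))"
    by (simp add: act_vec_def module_hom.sum[OF hom_ee_left] tens_sum_right
        single_eq_scl[of _ "A _ _ _ _"] module_hom.scale[OF hom_ee_left] tens_scl_right)
  finally show ?thesis .
qed

lemma hom_eeI:
  "module_hom scl scl (\<lambda>a. lin f (tens (ee s a b) w))" "module_hom scl scl (\<lambda>b. lin f (tens (ee s a b) w))"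
  "module_hom scl scl (\<lambda>a. lin f (tens w (ee s a b)))" "module_hom scl scl (\<lambda>b. lin f (tens w (ee s a b)))"
  by (intro hom_comp[OF module_hom_lin] hom_comp[OF module_hom_tens_left] hom_comp[OF module_hom_tens_right]
        hom_ee)+

text \<open>Acting with \<open>h\<close> conjugates the exponent of the bracket by \<open>h\<close>,
  and \<open>pairing_act\<close> conjugates it back, so the scalar is unchanged.\<close>

lemma bracket_act:
  assumes x: "x \<in> basis L" and y: "y \<in> basis L" and h: "h \<in> carrier G"
  shows "lin (bracket L) (tens (act L h x) (act L h y)) = lin (act L h) (bracket L (x, y))"
proof -
  obtain s u v where x: "s \<in> I" "u \<in> X s" "v \<in> X s" "x = E s u v"
    using x by (rule basis_cases)
  note [simp] = dg_closed[OF x(1)] x(2,3) h y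
  let ?v = "h \<otimes> dg s v \<otimes> inv h" and ?y = "h \<otimes> bdeg L y \<otimes> inv h"
  have "lin (bracket L) (tens (act L h x) (act L h y)) =
      scl (pairing s (inv ?v \<otimes> inv ?y \<otimes> ?v) (act_vec s h u) (act_dual s h v)) (lin (act L (inv ?v)) (act L h y))"
    using x homog_act[OF y h]
    by (simp add: act_E lin_bracket_ee[OF _ keys_act_vec homog_act_dual])
  also have "\<dots> = lin (act L h) (bracket L (x, y))"
    using x by (simp add: pairing_act act_act bracket_L lin_scl group_norm)
  finally show ?thesis .
qed

text \<open>The result visibly has degree \<open>d\<close>, that of the transformed
  \<open>y\<close>. Either the coefficient vanishes or \<open>A_dg\<close> forces \<open>d\<close>
  to be the product of the two degrees.\<close>

lemma homog_bracket:
  assumes x: "x \<in> basis L" and y: "y \<in> basis L"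
  shows "homog (basis L) (bdeg L) (bracket L (x, y)) (bdeg L x \<otimes> bdeg L y)"
proof -
  obtain s u v where x: "s \<in> I" "u \<in> X s" "v \<in> X s" "x = E s u v"
    using x by (rule basis_cases)
  define d where "d = inv (dg s v) \<otimes> bdeg L y \<otimes> dg s v"
  note [simp] = dg_closed[OF x(1)] x(2,3) y
  have [simp]: "d \<in> carrier G" by (simp add: d_def)
  have *: "inv (dg s v) \<otimes> inv (bdeg L y) \<otimes> dg s v = inv d" by (simp add: d_def group_norm)
  show ?thesis
  proof (cases "A s (inv d) v u = 0")
    case True
    then show ?thesis using x by (simp add: bracket_L * homog_def)
  next
    case False
    \<comment> \<open>The nonzero coefficient says that \<open>inv d\<close> conjugates the degree
      of \<open>u\<close> to that of \<open>v\<close>; this is the condition which the Kronecker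
      delta of the bracket expresses.\<close>
    have "dg s v = inv d \<otimes> dg s u \<otimes> inv (inv d)"
      using x False by (intro A_dg) auto
    then have "d \<otimes> dg s v = dg s u \<otimes> d" by (simp add: group_norm)
    then have "d = dg s u \<otimes> d \<otimes> inv (dg s v)"
      by (metis \<open>d \<in> carrier G\<close> inv_solve_right dg_closed m_closed x(1-3))
    then have "d = bdeg L x \<otimes> bdeg L y" using x by (simp add: bdeg_L d_def group_norm)
    moreover have "homog (basis L) (bdeg L) (bracket L (x, y)) d"
      using homog_scl[OF homog_act[OF y, of "inv (dg s v)"]] x by (simp add: bracket_L d_def)
    ultimately show ?thesis by simp
  qed
qed

lemma morphism_bracket: "crossed_morphism G (tensor_crossed G L L) L (bracket L)"
  unfolding crossed_morphism_iff_homog tensor_crossed_def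
  using homog_bracket bracket_act by auto

section \<open>The matrix coalgebra in the category of crossed modules\<close>

lemma comult_act:
  assumes x: "x \<in> basis L" and h: "h \<in> carrier G"
  shows "lin (act L h \<boxtimes> act L h) (comult L x) = lin (comult L) (act L h x)"
proof -
  obtain s u v where x: "s \<in> I" "u \<in> X s" "v \<in> X s" "x = E s u v"
    using x by (rule basis_cases)
  have *: "tens (ee s (act_vec s h u) (act_dual s h c)) (ee s (act_vec s h c) (act_dual s h v)) =
      (\<Sum>c'\<in>X s. \<Sum>c''\<in>X s. scl (A s h c'' c * A s (inv h) c c')
         (tens (ee s (act_vec s h u) (bas c')) (ee s (bas c'') (act_dual s h v))))" if "c \<in> X s" for c
    unfolding act_dual_def[of s h c] act_vec_def[of s h c]
    by (simp add: module_hom.sum[OF hom_ee_left] module_hom.sum[OF hom_ee_right]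
        single_eq_scl[of _ "A _ _ _ _"] module_hom.scale[OF hom_ee_left]
        module_hom.scale[OF hom_ee_right] tens_sum_left tens_sum_right
        tens_scl_left tens_scl_right scl.scale_sum_right mult.commute)
       (rule sum.swap)
  have "lin (act L h \<boxtimes> act L h) (comult L x) =
      (\<Sum>c\<in>X s. tens (ee s (act_vec s h u) (act_dual s h c)) (ee s (act_vec s h c) (act_dual s h v)))"
    using x h by (simp add: comult_L lin_sum act_E)
  also have "\<dots> = (\<Sum>c'\<in>X s. \<Sum>c''\<in>X s. \<Sum>c\<in>X s. scl (A s h c'' c * A s (inv h) c c')
         (tens (ee s (act_vec s h u) (bas c')) (ee s (bas c'') (act_dual s h v))))"
    by (simp add: *) (subst sum.swap, rule sum.cong[OF refl], rule sum.swap)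
  \<comment> \<open>The two inner legs form the canonical element of vectors and dual vectors, which
    is invariant: the sum over \<open>c\<close> multiplies \<open>A s h\<close> with
    \<open>A s (inv h)\<close>.\<close>
  also have "\<dots> = (\<Sum>c'\<in>X s. \<Sum>c''\<in>X s. scl (A s (h \<otimes> inv h) c'' c')
         (tens (ee s (act_vec s h u) (bas c')) (ee s (bas c'') (act_dual s h v))))"
    using x h by (intro sum.cong refl) (subst A_mult, auto simp: scl.scale_sum_left)
  also have "\<dots> = (\<Sum>c'\<in>X s. tens (ee s (act_vec s h u) (bas c')) (ee s (bas c') (act_dual s h v)))"
    using x h by (intro sum.cong refl)
      (simp add: A_one finite_X if_distrib[of "\<lambda>c. scl c _"] cong: if_cong)
  also have "\<dots> = lin (comult L) (act L h x)"
    using x h by (simp add: act_E lin_comult_ee keys_act_vec keys_act_dual)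
  finally show ?thesis .
qed

lemma morphism_comult: "crossed_morphism G L (tensor_crossed G L L) (comult L)"
  unfolding crossed_morphism_iff_homog
proof (intro conjI ballI)
  fix x assume "x \<in> basis L"
  then obtain s u v where x: "s \<in> I" "u \<in> X s" "v \<in> X s" "x = E s u v"
    by (rule basis_cases)
  have "homog (basis L \<times> basis L) (\<lambda>(x, y). bdeg L x \<otimes> bdeg L y) (comult L x) (bdeg L x)"
    unfolding x(4) comult_L[OF x(1-3)]
    using x by (intro homog_sum) (auto simp: homog_def bdeg_L dg_closed group_norm)
  then show "homog (basis (tensor_crossed G L L)) (bdeg (tensor_crossed G L L)) (comult L x) (bdeg L x)"
    by (simp add: tensor_crossed_def)
next
  fix h x assume "h \<in> carrier G" "x \<in> basis L"
  then show "lin (comult L) (act L h x) = lin (act (tensor_crossed G L L) h) (comult L x)"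
    by (simp add: tensor_crossed_def comult_act)
qed

lemma morphism_counit: "crossed_morphism G L (unit_crossed G) (counit L)"
  unfolding crossed_morphism_iff_homog
proof (intro conjI ballI)
  fix x assume "x \<in> basis L"
  then obtain s u v where x: "s \<in> I" "u \<in> X s" "v \<in> X s" "x = E s u v"
    by (rule basis_cases)
  show "homog (basis (unit_crossed G)) (bdeg (unit_crossed G)) (counit L x) (bdeg L x)"
    using x by (auto simp: homog_def unit_crossed_def counit_L bdeg_L dg_closed)
  fix h assume h: "h \<in> carrier G"
  have "lin (counit L) (act L h x) = scl (A s \<one> v u) (bas ())"
    using x h by (simp add: act_E lin_counit_ee keys_act_vec keys_act_dual pairing_act)
  also have "\<dots> = lin (act (unit_crossed G) h) (counit L x)"
    using x by (simp add: unit_crossed_def counit_L A_one)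
  finally show "lin (counit L) (act L h x) = lin (act (unit_crossed G) h) (counit L x)" .
qed

lemma coalgebra_L: "coalgebra_in_crossed G L"
  unfolding coalgebra_in_crossed_def
proof (intro conjI ballI crossed_module_L morphism_comult morphism_counit)
  fix x assume "x \<in> basis L"
  then obtain s u v where x: "s \<in> I" "u \<in> X s" "v \<in> X s" "x = E s u v"
    by (rule basis_cases)
  have "(assoc_r \<bullet> (comult L \<boxtimes> idm) \<bullet> comult L) x =
      (\<Sum>c\<in>X s. \<Sum>d\<in>X s. bas (E s u d, E s d c, E s c v))"
    using x by (simp add: mcomp_def comult_L lin_sum tens_sum_left assoc_r_def)
  also have "\<dots> = ((idm \<boxtimes> comult L) \<bullet> comult L) x"
    using x by (simp add: mcomp_def comult_L lin_sum tens_sum_right) (rule sum.swap)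
  finally show "(assoc_r \<bullet> (comult L \<boxtimes> idm) \<bullet> comult L) x = ((idm \<boxtimes> comult L) \<bullet> comult L) x" .
  have "(unitor_l \<bullet> (counit L \<boxtimes> idm) \<bullet> comult L) x =
      (\<Sum>c\<in>X s. if u = c then bas (E s u v) else 0)"
    unfolding mcomp_def x(4) comult_L[OF x(1-3)] lin_sum
    by (intro sum.cong refl) (use x in \<open>auto simp: counit_L unitor_l_def tens_def\<close>)
  then show "(unitor_l \<bullet> (counit L \<boxtimes> idm) \<bullet> comult L) x = idm x"
    using x by (simp add: finite_X)
  have "(unitor_r \<bullet> (idm \<boxtimes> counit L) \<bullet> comult L) x =
      (\<Sum>c\<in>X s. if v = c then bas (E s u v) else 0)"
    unfolding mcomp_def x(4) comult_L[OF x(1-3)] lin_sum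
    by (intro sum.cong refl) (use x in \<open>auto simp: counit_L unitor_r_def tens_def\<close>)
  then show "(unitor_r \<bullet> (idm \<boxtimes> counit L) \<bullet> comult L) x = idm x"
    using x by (simp add: finite_X)
qed

section \<open>The axioms of a braided-Lie algebra\<close>

text \<open>On the right both \<open>y\<close> and \<open>z\<close> end up under
  \<open>inv b\<close>, whatever the splitting index \<open>c\<close>. Covariance pulls
  \<open>inv b\<close> out of their bracket, and the sum over \<open>c\<close> is a matrix product
  whose exponent belongs to the degree of \<open>[y, z]\<close>.\<close>

lemma L1:
  assumes "x \<in> basis L" "y \<in> basis L" "z \<in> basis L"
  shows "(bracket L \<bullet> (idm \<boxtimes> bracket L)) (x, y, z) =
    (bracket L \<bullet> (bracket L \<boxtimes> bracket L) \<bullet> mid (braiding L L) \<bullet> (comult L \<boxtimes> idm)) (x, y, z)"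
proof -
  obtain s u v where x: "s \<in> I" "u \<in> X s" "v \<in> X s" "x = E s u v"
    using assms(1) by (rule basis_cases)
  define b where "b = dg s v"
  note [simp] = x(1-3) assms dg_closed[OF x(1)]
  have [simp]: "b \<in> carrier G" by (simp add: b_def)
  let ?a = "\<lambda>g. A s (inv b \<otimes> inv g \<otimes> b)"
  have yz: "homog (basis L) (bdeg L) (bracket L (y, z)) (bdeg L y \<otimes> bdeg L z)"
    by (simp add: homog_bracket)
  have "(bracket L \<bullet> (bracket L \<boxtimes> bracket L) \<bullet> mid (braiding L L) \<bullet> (comult L \<boxtimes> idm)) (x, y, z) =
      (\<Sum>c\<in>X s. lin (bracket L) (tens
         (lin (bracket L) (tens (bas (E s u c)) (act L (dg s c \<otimes> inv b) y)))
         (bracket L (E s c v, z))))"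
    by (simp add: mcomp_def x(4) comult_L lin_sum tens_sum_left mid_eq[where f = "braiding L L", OF braiding_L] bdeg_L b_def)
  also have "\<dots> = (\<Sum>c\<in>X s. lin (bracket L) (tens
         (scl (?a (bdeg L y) c u) (act L (inv b) y)) (scl (?a (bdeg L z) v c) (act L (inv b) z))))"
    by (intro sum.cong refl arg_cong[of _ _ "lin _"] arg_cong2[of _ _ _ _ tens])
       (simp_all add: lin_bracket_E_act bracket_L b_def group_norm)
  also have "\<dots> = (\<Sum>c\<in>X s. scl (?a (bdeg L z) v c * ?a (bdeg L y) c u)
       (lin (act L (inv b)) (bracket L (y, z))))"
    by (simp add: tens_scl_left tens_scl_right lin_scl bracket_act mult.commute)
  also have "\<dots> = scl (?a (bdeg L y \<otimes> bdeg L z) v u) (lin (act L (inv b)) (bracket L (y, z)))"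
    by (subst scl.scale_sum_left[symmetric], subst A_mult[symmetric]) (simp_all add: group_norm)
  also have "\<dots> = (bracket L \<bullet> (idm \<boxtimes> bracket L)) (x, y, z)"
    using lin_bracket_E[OF x(1-3) yz] by (simp add: mcomp_def x(4) b_def)
  finally show ?thesis by simp
qed

text \<open>The final braiding acts with \<open>d\<close> on the second leg of the fundamental
  braiding. It undoes \<open>inv d\<close> on \<open>u\<close> and acts on the dual vector
  \<open>v\<close> instead, whose coefficients are those of the bracket.\<close>

lemma L2:
  assumes "x \<in> basis L" "y \<in> basis L"
  shows "(braiding L L \<bullet> fund_braiding L) (x, y) =
    ((idm \<boxtimes> bracket L) \<bullet> assoc_r \<bullet> (comult L \<boxtimes> idm)) (x, y)"
proof -
  obtain s u v where x: "s \<in> I" "u \<in> X s" "v \<in> X s" "x = E s u v"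
    using assms(1) by (rule basis_cases)
  define b where "b = dg s v"
  define d where "d = inv b \<otimes> bdeg L y \<otimes> b"
  note [simp] = x(1-3) assms dg_closed[OF x(1)]
  have [simp]: "b \<in> carrier G" "d \<in> carrier G" by (simp_all add: b_def d_def)
  have d: "inv b \<otimes> inv (bdeg L y) \<otimes> b = inv d" by (simp add: d_def group_norm)
  have hom: "homog (basis L) (bdeg L) (act L (inv b) y) d"
    using homog_act[of y "inv b"] by (simp add: d_def)
  have "(braiding L L \<bullet> fund_braiding L) (x, y) =
      tens (lin (act L d) (ee s (act_vec s (inv d) u) (bas v))) (act L (inv b) y)"
    by (simp add: mcomp_def x(4) fund_braiding_E d lin_braiding[OF hom] flip: b_def)
  also have "\<dots> = tens (ee s (bas u) (act_dual s d v)) (act L (inv b) y)"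
    by (simp add: lin_act_ee keys_act_vec act_vec_mult act_vec_one)
  also have "\<dots> = (\<Sum>c\<in>X s. tens (bas (E s u c)) (scl (A s (inv d) v c) (act L (inv b) y)))"
    by (simp add: act_dual_def module_hom.sum[OF hom_ee_right] tens_sum_left
        single_eq_scl[of _ "A _ _ _ _"] module_hom.scale[OF hom_ee_right] tens_scl_left tens_scl_right)
  also have "\<dots> = ((idm \<boxtimes> bracket L) \<bullet> assoc_r \<bullet> (comult L \<boxtimes> idm)) (x, y)"
    by (simp add: mcomp_def x(4) comult_L lin_sum tens_sum_left assoc_r_def bracket_L d flip: b_def)
  finally show ?thesis .
qed

text \<open>As in \<open>L1\<close>, the sum over the splitting index of \<open>x\<close> multiplies
  the two matrices. The degrees of the two factors of each term in the coproduct of \<open>y\<close>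
  multiply to that of \<open>y\<close>, so one scalar remains and covariance of
  \<open>comult L\<close> finishes.\<close>

lemma L3_comult:
  assumes "x \<in> basis L" "y \<in> basis L"
  shows "(comult L \<bullet> bracket L) (x, y) =
    ((bracket L \<boxtimes> bracket L) \<bullet> mid (braiding L L) \<bullet> (comult L \<boxtimes> comult L)) (x, y)"
proof -
  obtain s u v where x: "s \<in> I" "u \<in> X s" "v \<in> X s" "x = E s u v"
    using assms(1) by (rule basis_cases)
  obtain t p q where y: "t \<in> I" "p \<in> X t" "q \<in> X t" "y = E t p q"
    using assms(2) by (rule basis_cases)
  define b where "b = dg s v"
  note [simp] = x(1-3) y(1-3) dg_closed[OF x(1)] dg_closed[OF y(1)]
  have [simp]: "b \<in> carrier G" by (simp add: b_def)
  let ?a = "\<lambda>g. A s (inv b \<otimes> inv g \<otimes> b)"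
  have "((bracket L \<boxtimes> bracket L) \<bullet> mid (braiding L L) \<bullet> (comult L \<boxtimes> comult L)) (x, y) =
      (\<Sum>e\<in>X t. \<Sum>c\<in>X s. tens
         (lin (bracket L) (tens (bas (E s u c)) (act L (dg s c \<otimes> inv b) (E t p e))))
         (bracket L (E s c v, E t e q)))"
    by (simp add: mcomp_def x(4) y(4) comult_L lin_sum tens_sum_left tens_sum_right
        mid_eq[where f = "braiding L L", OF braiding_L] bdeg_L b_def)
  also have "\<dots> = (\<Sum>e\<in>X t. \<Sum>c\<in>X s.
      scl (?a (bdeg L (E t e q)) v c * ?a (bdeg L (E t p e)) c u)
        (tens (act L (inv b) (E t p e)) (act L (inv b) (E t e q))))"
    by (intro sum.cong refl)
       (simp add: lin_bracket_E_act bracket_L basis_E b_def group_norm tens_scl_left tens_scl_right mult.commute)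
  also have "\<dots> = (\<Sum>e\<in>X t. scl (?a (bdeg L y) v u)
        (tens (act L (inv b) (E t p e)) (act L (inv b) (E t e q))))"
    by (intro sum.cong refl, subst scl.scale_sum_left[symmetric], subst A_mult[symmetric])
       (simp_all add: group_norm basis_E y(4) bdeg_L)
  also have "\<dots> = scl (?a (bdeg L y) v u) (lin (act L (inv b) \<boxtimes> act L (inv b)) (comult L y))"
    by (simp add: y(4) comult_L lin_sum scl.scale_sum_right)
  also have "\<dots> = (comult L \<bullet> bracket L) (x, y)"
    by (simp add: mcomp_def x(4) bracket_L comult_act assms lin_scl b_def)
  finally show ?thesis by simp
qed

lemma L3_counit:
  assumes "x \<in> basis L" "y \<in> basis L"
  shows "(counit L \<bullet> bracket L) (x, y) = (unitor_l \<bullet> (counit L \<boxtimes> counit L)) (x, y)"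
proof -
  obtain s u v where x: "s \<in> I" "u \<in> X s" "v \<in> X s" "x = E s u v"
    using assms(1) by (rule basis_cases)
  obtain t p q where y: "t \<in> I" "p \<in> X t" "q \<in> X t" "y = E t p q"
    using assms(2) by (rule basis_cases)
  note [simp] = x(1-3) y(1-3) dg_closed[OF x(1)] dg_closed[OF y(1)]
  have "lin (counit L) (act L (inv (dg s v)) y) = counit L y"
    using morphism_counit assms by (simp add: crossed_morphism_def unit_crossed_def)
  \<comment> \<open>The counit of \<open>y\<close> vanishes unless \<open>p = q\<close>, and then
    \<open>y\<close> has degree \<open>\<one>\<close>, which turns the bracket coefficient into the
    counit of \<open>x\<close>.\<close>
  moreover have "A s (inv (dg s v) \<otimes> inv (bdeg L y) \<otimes> dg s v) v u = (if u = v then 1 else 0)" if "p = q"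
    using that by (simp add: y(4) bdeg_L A_one)
  ultimately show ?thesis
    using assms(2) by (cases "p = q")
      (simp_all add: mcomp_def x(4) bracket_L lin_scl, simp_all add: y(4) counit_L, auto simp: unitor_l_def tens_def)
qed

theorem left_braided_Lie: "left_braided_Lie_algebra G L"
  unfolding left_braided_Lie_algebra_def
  using coalgebra_L morphism_bracket L1 L2 L3_comult L3_counit by auto

section \<open>The inverse of the fundamental braiding and regularity\<close>

definition split_E :: "'b \<Rightarrow> 'i \<times> 'x \<times> 'x" where
  "split_E = inv_into (SIGMA s:I. X s \<times> X s) (\<lambda>(s, u, v). E s u v)"

lemma split_E [simp]: "s \<in> I \<Longrightarrow> u \<in> X s \<Longrightarrow> v \<in> X s \<Longrightarrow> split_E (E s u v) = (s, u, v)"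
  using inv_into_f_f[OF E_inj, of "(s, u, v)"] by (simp add: split_E_def)

text \<open>The dual vector \<open>v\<close> passes through the fundamental braiding unchanged, so
  its degree remains available to undo the action on \<open>y\<close>. The degree of the first leg
  is then exactly what undoes the twist of \<open>u\<close>. Since \<open>E\<close> is merely
  injective, the indices are read off by \<open>split_E\<close>.\<close>

definition fund_inv :: "'b \<times> 'b \<Rightarrow> ('b \<times> 'b \<Rightarrow>\<^sub>0 'k)" where
  "fund_inv = (\<lambda>(y, x). case split_E x of (s, u, v) \<Rightarrow>
     tens (ee s (act_vec s (bdeg L y) u) (bas v)) (act L (dg s v) y))"

lemma lin_fund_braiding:
  assumes "s \<in> I" "Poly_Mapping.keys a \<subseteq> X s" "homog (X s) (dg s) b g"
    and "homog (basis L) (bdeg L) w m"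
  shows "lin (fund_braiding L) (tens (ee s a b) w) =
    tens (lin (act L (inv g)) w) (ee s (lin (act_vec s (inv g \<otimes> inv m \<otimes> g)) a) b)"
  by (rule trilinear_ext[of "\<lambda>a b w. lin (fund_braiding L) (tens (ee s a b) w)"
        "\<lambda>a b w. tens (lin (act L (inv g)) w) (ee s (lin (act_vec s (inv g \<otimes> inv m \<otimes> g)) a) b)"])
     (use assms in \<open>auto intro!: hom_intros hom_eeI hom_comp[OF module_hom_tens_right hom_ee_right]
        hom_comp[OF module_hom_tens_right hom_comp[OF hom_ee_left module_hom_lin]]
        simp: fund_braiding_E homog_def subsetD\<close>)

lemma lin_fund_inv:
  assumes "s \<in> I" "Poly_Mapping.keys a \<subseteq> X s" "homog (X s) (dg s) b g"
    and "homog (basis L) (bdeg L) w m"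
  shows "lin fund_inv (tens w (ee s a b)) =
    tens (ee s (lin (act_vec s m) a) b) (lin (act L g) w)"
  by (rule trilinear_ext[of "\<lambda>a b w. lin fund_inv (tens w (ee s a b))"
        "\<lambda>a b w. tens (ee s (lin (act_vec s m) a) b) (lin (act L g) w)"])
     (use assms in \<open>auto intro!: hom_intros hom_eeI hom_comp[OF module_hom_tens_left hom_ee_right]
        hom_comp[OF module_hom_tens_left hom_comp[OF hom_ee_left module_hom_lin]]
        simp: fund_inv_def homog_def subsetD\<close>)

lemma homog_tensor_crossed:
  "homog (basis L) (bdeg L) v g \<Longrightarrow> homog (basis L) (bdeg L) w h \<Longrightarrow> k = g \<otimes> h \<Longrightarrow>
    homog (basis (tensor_crossed G L L)) (bdeg (tensor_crossed G L L)) (tens v w) k"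
  by (auto simp: homog_def keys_tens tensor_crossed_def)

text \<open>Acting with \<open>h\<close> first conjugates the group elements in
  \<open>fund_braiding_E\<close> by \<open>h\<close>; composed with the action of \<open>h\<close>
  on \<open>y\<close> and \<open>u\<close> they become \<open>h \<otimes> inv b\<close> and
  \<open>h \<otimes> d\<close>, as when \<open>h\<close> acts last.\<close>

lemma morphism_fund_braiding:
  "crossed_morphism G (tensor_crossed G L L) (tensor_crossed G L L) (fund_braiding L)"
  unfolding crossed_morphism_iff_homog
proof (intro conjI ballI)
  fix t assume "t \<in> basis (tensor_crossed G L L)"
  then obtain x y where t: "t = (x, y)" "x \<in> basis L" "y \<in> basis L"
    by (auto simp: tensor_crossed_def)
  obtain s u v where x: "s \<in> I" "u \<in> X s" "v \<in> X s" "x = E s u v"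
    using t(2) by (rule basis_cases)
  define b where "b = dg s v"
  define d where "d = inv b \<otimes> inv (bdeg L y) \<otimes> b"
  note [simp] = x(1-3) t dg_closed[OF x(1)]
  have [simp]: "b \<in> carrier G" "d \<in> carrier G" by (simp_all add: b_def d_def)
  have fund: "fund_braiding L t = tens (act L (inv b) y) (ee s (act_vec s d u) (bas v))"
    by (simp add: x(4) fund_braiding_E b_def d_def)
  show "homog (basis (tensor_crossed G L L)) (bdeg (tensor_crossed G L L)) (fund_braiding L t)
      (bdeg (tensor_crossed G L L) t)"
    unfolding fund
    by (rule homog_tensor_crossed[OF homog_act homog_ee[OF _ homog_act_vec homog_bas]])
       (simp_all add: x(4) tensor_crossed_def bdeg_L group_norm d_def flip: b_def)
  fix h assume [simp]: "h \<in> carrier G"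
  have "lin (fund_braiding L) (act (tensor_crossed G L L) h t) =
      lin (fund_braiding L) (tens (ee s (act_vec s h u) (act_dual s h v)) (act L h y))"
    by (simp add: x(4) tensor_crossed_def act_E)
  also have "\<dots> = tens (act L (h \<otimes> inv b) y) (ee s (act_vec s (h \<otimes> d) u) (act_dual s h v))"
    by (subst lin_fund_braiding[OF _ keys_act_vec homog_act_dual homog_act])
       (simp_all add: act_act act_vec_mult group_norm d_def flip: b_def)
  also have "\<dots> = lin (act (tensor_crossed G L L) h) (fund_braiding L t)"
    by (simp add: fund[unfolded t(1)] tensor_crossed_def act_act lin_act_ee keys_act_vec act_vec_mult)
  finally show "lin (fund_braiding L) (act (tensor_crossed G L L) h t) =
    lin (act (tensor_crossed G L L) h) (fund_braiding L t)" .
qed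

lemma morphism_fund_inv:
  "crossed_morphism G (tensor_crossed G L L) (tensor_crossed G L L) fund_inv"
  unfolding crossed_morphism_iff_homog
proof (intro conjI ballI)
  fix t assume "t \<in> basis (tensor_crossed G L L)"
  then obtain x y where t: "t = (y, x)" "x \<in> basis L" "y \<in> basis L"
    by (auto simp: tensor_crossed_def)
  obtain s u v where x: "s \<in> I" "u \<in> X s" "v \<in> X s" "x = E s u v"
    using t(2) by (rule basis_cases)
  define b where "b = dg s v"
  note [simp] = x(1-3) t dg_closed[OF x(1)]
  have [simp]: "b \<in> carrier G" by (simp add: b_def)
  have fund: "fund_inv t = tens (ee s (act_vec s (bdeg L y) u) (bas v)) (act L b y)"
    by (simp add: x(4) fund_inv_def b_def)
  show "homog (basis (tensor_crossed G L L)) (bdeg (tensor_crossed G L L)) (fund_inv t)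
      (bdeg (tensor_crossed G L L) t)"
    unfolding fund
    by (rule homog_tensor_crossed[OF homog_ee[OF _ homog_act_vec homog_bas] homog_act])
       (simp_all add: x(4) tensor_crossed_def bdeg_L group_norm flip: b_def)
  fix h assume [simp]: "h \<in> carrier G"
  have "lin fund_inv (act (tensor_crossed G L L) h t) =
      lin fund_inv (tens (act L h y) (ee s (act_vec s h u) (act_dual s h v)))"
    by (simp add: x(4) tensor_crossed_def act_E)
  also have "\<dots> = tens (ee s (act_vec s (h \<otimes> bdeg L y) u) (act_dual s h v)) (act L (h \<otimes> b) y)"
    by (subst lin_fund_inv[OF _ keys_act_vec homog_act_dual homog_act])
       (simp_all add: act_act act_vec_mult group_norm flip: b_def)
  also have "\<dots> = lin (act (tensor_crossed G L L) h) (fund_inv t)"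
    by (simp add: fund[unfolded t(1)] tensor_crossed_def act_act lin_act_ee keys_act_vec act_vec_mult)
  finally show "lin fund_inv (act (tensor_crossed G L L) h t) =
    lin (act (tensor_crossed G L L) h) (fund_inv t)" .
qed

theorem regular_L: "regular G L"
  unfolding regular_def crossed_iso_def
proof (intro conjI exI[of _ fund_inv] ballI morphism_fund_braiding morphism_fund_inv)
  fix t assume "t \<in> basis (tensor_crossed G L L)"
  then obtain x y where t: "t = (x, y)" "x \<in> basis L" "y \<in> basis L"
    by (auto simp: tensor_crossed_def)
  obtain s u v where x: "s \<in> I" "u \<in> X s" "v \<in> X s" "x = E s u v"
    using t(2) by (rule basis_cases)
  note [simp] = x(1-3) t(2,3) dg_closed[OF x(1)]
  show "(fund_inv \<bullet> fund_braiding L) t = idm t"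
    unfolding t x(4) mcomp_def fund_braiding_E[OF x(1-3) t(3)]
    by (subst lin_fund_inv[OF _ keys_act_vec homog_bas homog_act])
       (simp_all add: act_act act_one act_vec_mult act_vec_one group_norm)
next
  fix t assume "t \<in> basis (tensor_crossed G L L)"
  then obtain x y where t: "t = (y, x)" "x \<in> basis L" "y \<in> basis L"
    by (auto simp: tensor_crossed_def)
  obtain s u v where x: "s \<in> I" "u \<in> X s" "v \<in> X s" "x = E s u v"
    using t(2) by (rule basis_cases)
  note [simp] = x(1-3) t(2,3) dg_closed[OF x(1)]
  have "fund_inv t = tens (ee s (act_vec s (bdeg L y) u) (bas v)) (act L (dg s v) y)"
    by (simp add: fund_inv_def t x(4))
  \<comment> \<open>The vector \<open>act L (dg s v) y\<close> has the degree of \<open>y\<close>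
    conjugated by \<open>dg s v\<close>, so the new twist is by \<open>inv (bdeg L y)\<close> and
    cancels the old one.\<close>
  then show "(fund_braiding L \<bullet> fund_inv) t = idm t"
    unfolding mcomp_def
    by (simp, subst lin_fund_braiding[OF _ keys_act_vec homog_bas homog_act])
       (simp_all add: act_act act_one act_vec_mult act_vec_one group_norm t(1) x(4))
qed

section \<open>Units from one-dimensional blocks\<close>

lemma act_singleton:
  assumes "s \<in> I" "X s = {w}" "h \<in> carrier G"
  shows "act L h (E s w w) = bas (E s w w)"
proof -
  have "A s h w w * A s (inv h) w w = 1"
    using A_mult[of s w w h "inv h"] A_one[of s w w] assms by simp
  then show ?thesis using act_L[of s w w h] assms by simp
qed

text \<open>The matrix unit of a one-dimensional block is grouplike, invariant and of degree
  \<open>\<one>\<close>. Bracketing into it therefore gives the counit, so of L4 only the left unit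
  law has to be supplied.\<close>

theorem unital_L:
  assumes s: "s \<in> I" "X s = {w}"
    and y: "\<And>y. y \<in> basis L \<Longrightarrow> bracket L (E s w w, y) = bas y"
  shows "unital G L"
proof -
  have [simp]: "s \<in> I" "w \<in> X s" "dg s w \<in> carrier G" using s by (auto intro: dg_closed)
  note act = act_singleton[OF s]
  show ?thesis
    unfolding unital_def
  proof (intro exI[of _ "\<lambda>_. bas (E s w w)"] conjI ballI)
    show "crossed_morphism G (unit_crossed G) L (\<lambda>_. bas (E s w w))"
      by (auto simp: crossed_morphism_def unit_crossed_def bdeg_L act)
    show "(comult L \<bullet> (\<lambda>_. bas (E s w w))) () = ((\<lambda>_. bas (E s w w)) \<boxtimes> (\<lambda>_. bas (E s w w))) ((), ())"
      using s by (simp add: mcomp_def comult_L)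
    show "(counit L \<bullet> (\<lambda>_. bas (E s w w))) () = bas ()"
      by (simp add: mcomp_def counit_L)
    fix x assume "x \<in> basis L"
    then show "(bracket L \<bullet> ((\<lambda>_. bas (E s w w)) \<boxtimes> idm)) ((), x) = unitor_l ((), x)"
      by (simp add: mcomp_def y unitor_l_def)
    from \<open>x \<in> basis L\<close> obtain t p q where x: "t \<in> I" "p \<in> X t" "q \<in> X t" "x = E t p q"
      by (rule basis_cases)
    then show "(bracket L \<bullet> (idm \<boxtimes> (\<lambda>_. bas (E s w w)))) (x, ()) =
        ((\<lambda>_. bas (E s w w)) \<bullet> counit L \<bullet> unitor_r) (x, ())"
      by (auto simp: mcomp_def bracket_L act basis_E bdeg_L dg_closed A_one unitor_r_def counit_L)
  qed
qed

end

section \<open>Blocks of conjugacy classes and representations of centralisers\<close>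

lemma tens_single:
  "tens (Poly_Mapping.single x a) (Poly_Mapping.single y b) = Poly_Mapping.single (x, y) (a * b)"
  by (rule poly_mapping_eqI) (auto simp: lookup_tens lookup_single when_def split_paired_all)

text \<open>The matrix of \<open>h\<close> on \<open>V_cr G scale p\<close>.\<close>

definition coef :: "('g, 'a) monoid_scheme \<Rightarrow> ('k::field \<Rightarrow> 'v::ab_group_add \<Rightarrow> 'v) \<Rightarrow>
    ('g, 'v) pair_data \<Rightarrow> 'g \<Rightarrow> 'g \<times> 'v \<Rightarrow> 'g \<times> 'v \<Rightarrow> 'k" where
  "coef G scale p h = (\<lambda>(d, j) (c, i).
     if d = h \<otimes>\<^bsub>G\<^esub> c \<otimes>\<^bsub>G\<^esub> inv\<^bsub>G\<^esub> h then mat scale p (zeta G p c h) j i else 0)"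

locale pair_block = group G + vector_space scale
  for G :: "('g, 'a) monoid_scheme" (structure)
    and scale :: "'k::field \<Rightarrow> 'v::ab_group_add \<Rightarrow> 'v" +
  fixes p :: "('g, 'v) pair_data"
  assumes finite_G: "finite (carrier G)" and pair: "class_irrep_pair G scale p"
begin

lemma base_closed [simp]: "base p \<in> carrier G"
  and finite_vbasis: "finite (vbasis p)"
  and independent_vbasis: "independent (vbasis p)"
  and qmap_closed: "c \<in> cls p \<Longrightarrow> qmap p c \<in> carrier G"
  and qmap_conj: "c \<in> cls p \<Longrightarrow> qmap p c \<otimes> base p \<otimes> inv (qmap p c) = c"
  and cls_eq: "cls p = conj_class G (base p)"
  using pair by (simp_all add: class_irrep_pair_def)

lemma is_representation_rep: "is_representation G (centraliser G (base p)) scale (span (vbasis p)) (rep p)"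
  using pair by (simp add: class_irrep_pair_def is_irreducible_def)

lemma cls_closed [simp]: "c \<in> cls p \<Longrightarrow> c \<in> carrier G"
  by (auto simp: cls_eq conj_class_def)

lemma finite_cls: "finite (cls p)"
  using cls_closed finite_G by (meson finite_subset subsetI)

lemma cls_conj:
  assumes "c \<in> cls p" "h \<in> carrier G"
  shows "h \<otimes> c \<otimes> inv h \<in> cls p"
proof -
  obtain g where "g \<in> carrier G" "c = g \<otimes> base p \<otimes> inv g"
    using assms(1) unfolding cls_eq conj_class_def by blast
  then have "h \<otimes> g \<in> carrier G" "h \<otimes> c \<otimes> inv h = (h \<otimes> g) \<otimes> base p \<otimes> inv (h \<otimes> g)"
    using assms(2) by (simp_all add: group_norm)
  then show ?thesis unfolding cls_eq conj_class_def by blast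
qed

section \<open>The cocycle \<open>zeta\<close> and the representation of the centraliser\<close>

lemma centraliser_closed: "g \<in> centraliser G r \<Longrightarrow> g \<in> carrier G"
  by (simp add: centraliser_def)

text \<open>Both \<open>q'\<close> and \<open>h \<otimes> q\<close> conjugate the base point to
  \<open>h \<otimes> c \<otimes> inv h\<close>, hence they differ by an element that commutes with
  it.\<close>

lemma zeta_centraliser:
  assumes "c \<in> cls p" "h \<in> carrier G"
  shows "zeta G p c h \<in> centraliser G (base p)"
proof -
  define q q' where "q = qmap p c" and "q' = qmap p (h \<otimes> c \<otimes> inv h)"
  have [simp]: "q \<in> carrier G" "q' \<in> carrier G"
    using assms by (simp_all add: q_def q'_def qmap_closed cls_conj)
  have c: "c = q \<otimes> base p \<otimes> inv q" and c': "h \<otimes> c \<otimes> inv h = q' \<otimes> base p \<otimes> inv q'"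
    using assms by (simp_all add: q_def q'_def qmap_conj cls_conj)
  have "inv q' \<otimes> h \<otimes> q \<otimes> base p = inv q' \<otimes> (h \<otimes> c \<otimes> inv h) \<otimes> h \<otimes> q"
    using assms by (simp add: c group_norm)
  also have "\<dots> = base p \<otimes> (inv q' \<otimes> h \<otimes> q)"
    using assms by (simp add: c' group_norm)
  finally show ?thesis
    using assms by (simp add: centraliser_def zeta_def flip: q_def q'_def)
qed

lemma zeta_one: "c \<in> cls p \<Longrightarrow> zeta G p c \<one> = \<one>"
  by (simp add: zeta_def qmap_closed)

text \<open>The cocycle identity: the intermediate value of \<open>qmap p\<close> at
  \<open>h \<otimes> c \<otimes> inv h\<close> cancels.\<close>

lemma zeta_mult:
  assumes "c \<in> cls p" "g \<in> carrier G" "h \<in> carrier G"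
  shows "zeta G p c (g \<otimes> h) = zeta G p (h \<otimes> c \<otimes> inv h) g \<otimes> zeta G p c h"
  using assms qmap_closed[OF cls_conj[OF assms(1), of "g \<otimes> h"]]
    qmap_closed[OF cls_conj[OF assms(1,3)]]
  by (simp add: zeta_def group_norm qmap_closed)

text \<open>The cocycle identity for \<open>inv h\<close> and \<open>h\<close>. It turns the inverse
  cocycle in the dual action into matrix coefficients of \<open>inv h\<close>.\<close>

lemma zeta_inv:
  assumes "c \<in> cls p" "h \<in> carrier G"
  shows "inv (zeta G p c h) = zeta G p (h \<otimes> c \<otimes> inv h) (inv h)"
proof -
  have "zeta G p (h \<otimes> c \<otimes> inv h) (inv h) \<otimes> zeta G p c h = \<one>"
    using assms zeta_mult[of c "inv h" h] by (simp add: zeta_one)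
  then show ?thesis
    using assms by (intro inv_equality) (auto intro: centraliser_closed zeta_centraliser cls_conj)
qed

lemma rep_span: "h \<in> centraliser G (base p) \<Longrightarrow> u \<in> span (vbasis p) \<Longrightarrow> rep p h u \<in> span (vbasis p)"
  and rep_add: "h \<in> centraliser G (base p) \<Longrightarrow> u \<in> span (vbasis p) \<Longrightarrow> v \<in> span (vbasis p) \<Longrightarrow>
    rep p h (u + v) = rep p h u + rep p h v"
  and rep_scale: "h \<in> centraliser G (base p) \<Longrightarrow> u \<in> span (vbasis p) \<Longrightarrow>
    rep p h (scale c u) = scale c (rep p h u)"
  and rep_one: "u \<in> span (vbasis p) \<Longrightarrow> rep p \<one> u = u"
  and rep_mult: "g \<in> centraliser G (base p) \<Longrightarrow> h \<in> centraliser G (base p) \<Longrightarrow> u \<in> span (vbasis p) \<Longrightarrow>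
    rep p (g \<otimes> h) u = rep p g (rep p h u)"
  using is_representation_rep unfolding is_representation_def by blast+

lemma rep_sum:
  assumes "h \<in> centraliser G (base p)" "\<And>i. i \<in> S \<Longrightarrow> f i \<in> span (vbasis p)"
  shows "rep p h (\<Sum>i\<in>S. f i) = (\<Sum>i\<in>S. rep p h (f i))"
  using assms(2)
proof (induction S rule: infinite_finite_induct)
  case (insert x S)
  then show ?case by (simp add: rep_add assms(1) span_sum)
\<comment> \<open>Empty and infinite sums are both 0, and \<open>rep p h\<close> fixes 0 because it
  commutes with scaling by 0.\<close>
qed (use rep_scale[OF assms(1) span_zero, of 0] in simp_all)

lemma mat_one: "u \<in> vbasis p \<Longrightarrow> mat scale p \<one> v u = (if v = u then 1 else 0)"
  by (simp add: mat_def rep_one span_base representation_basis independent_vbasis)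

lemma mat_mult:
  assumes "u \<in> vbasis p" "g \<in> centraliser G (base p)" "h \<in> centraliser G (base p)"
  shows "mat scale p (g \<otimes> h) w u = (\<Sum>v\<in>vbasis p. mat scale p g w v * mat scale p h v u)"
proof -
  have u: "u \<in> span (vbasis p)" using assms(1) by (rule span_base)
  have *: "rep p h u = (\<Sum>v\<in>vbasis p. scale (mat scale p h v u) v)"
    unfolding mat_def
    by (rule sum_representation_eq[symmetric])
       (use assms u in \<open>simp_all add: rep_span independent_vbasis finite_vbasis\<close>)
  have "rep p (g \<otimes> h) u = (\<Sum>v\<in>vbasis p. scale (mat scale p h v u) (rep p g v))"
    unfolding rep_mult[OF assms(2,3) u] *
    by (simp add: rep_sum assms span_scale span_base rep_scale)
  then show ?thesis
    using assms(2) unfolding mat_def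
    by (simp add: representation_sum independent_vbasis span_scale span_base rep_span representation_scale mult.commute)
qed

section \<open>Matrix coefficients of the induced crossed module and of its dual\<close>

abbreviation X where "X \<equiv> cls p \<times> vbasis p"

lemma finite_X: "finite X"
  by (simp add: finite_cls finite_vbasis)

lemma coef_one: "u \<in> X \<Longrightarrow> coef G scale p \<one> v u = (if v = u then 1 else 0)"
  by (cases v) (auto simp: coef_def zeta_one mat_one split: if_splits)

text \<open>A group element maps the component of one class element into that of a single other one,
  so sums over \<open>X\<close> collapse to sums over \<open>vbasis p\<close>.\<close>

lemma sum_X:
  assumes "c' \<in> cls p" "\<And>j. j \<in> vbasis p \<Longrightarrow> f (c', j) = g j"
    and "\<And>c j. c \<in> cls p \<Longrightarrow> j \<in> vbasis p \<Longrightarrow> c \<noteq> c' \<Longrightarrow> f (c, j) = 0"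
  shows "sum f X = sum g (vbasis p)"
proof -
  have "sum f X = (\<Sum>c\<in>cls p. if c = c' then sum g (vbasis p) else 0)"
    unfolding sum.cartesian_product'
    by (intro sum.cong refl) (auto simp: assms(2,3) intro!: sum.neutral)
  then show ?thesis using assms(1) by (simp add: finite_cls)
qed

text \<open>Only the class element \<open>h \<otimes> c \<otimes> inv h\<close> contributes to the
  sum; over it the claim is multiplicativity of the representation combined with
  \<open>zeta_mult\<close>.\<close>

lemma coef_mult:
  assumes "u \<in> X" "g \<in> carrier G" "h \<in> carrier G"
  shows "coef G scale p (g \<otimes> h) w u = (\<Sum>v\<in>X. coef G scale p g w v * coef G scale p h v u)"
proof -
  obtain d k where w: "w = (d, k)" by (cases w)
  obtain c i where u: "u = (c, i)" "c \<in> cls p" "i \<in> vbasis p" using assms(1) by auto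
  define c' where "c' = h \<otimes> c \<otimes> inv h"
  have c': "c' \<in> cls p" unfolding c'_def using u assms by (simp add: cls_conj)
  have "(\<Sum>v\<in>X. coef G scale p g w v * coef G scale p h v u) =
      (\<Sum>j\<in>vbasis p. coef G scale p g w (c', j) * mat scale p (zeta G p c h) j i)"
    by (rule sum_X[OF c']) (auto simp: coef_def u c'_def)
  also have "\<dots> = (if d = g \<otimes> c' \<otimes> inv g then
      (\<Sum>j\<in>vbasis p. mat scale p (zeta G p c' g) k j * mat scale p (zeta G p c h) j i) else 0)"
    by (auto simp: coef_def w)
  also have "\<dots> = (if d = g \<otimes> c' \<otimes> inv g then mat scale p (zeta G p c' g \<otimes> zeta G p c h) k i else 0)"
    using u c' assms by (simp add: mat_mult zeta_centraliser)
  also have "\<dots> = coef G scale p (g \<otimes> h) w u"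
    using u assms by (simp add: coef_def w zeta_mult c'_def group_norm)
  finally show ?thesis by simp
qed

lemma act_V_cr:
  assumes "u \<in> X" "h \<in> carrier G"
  shows "act (V_cr G scale p) h u = (\<Sum>v\<in>X. Poly_Mapping.single v (coef G scale p h v u))"
proof -
  obtain c i where u: "u = (c, i)" "c \<in> cls p" "i \<in> vbasis p" using assms(1) by auto
  show ?thesis
    unfolding u(1) V_cr_def
    by (simp, rule sum_X[symmetric, of "h \<otimes> c \<otimes> inv h"])
       (use u assms in \<open>auto simp: coef_def cls_conj\<close>)
qed

text \<open>The row of \<open>coef\<close> for \<open>inv h\<close> at \<open>u\<close> is supported
  over the conjugate of the class element of \<open>u\<close> by \<open>h\<close>, where
  \<open>zeta_inv\<close> identifies its entries with those of the dual action.\<close>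

lemma act_V_dual_cr:
  assumes "u \<in> X" "h \<in> carrier G"
  shows "act (V_dual_cr G scale p) h u = (\<Sum>v\<in>X. Poly_Mapping.single v (coef G scale p (inv h) u v))"
proof -
  obtain c i where u: "u = (c, i)" "c \<in> cls p" "i \<in> vbasis p" using assms(1) by auto
  have *: "c = inv h \<otimes> d \<otimes> h \<longleftrightarrow> d = h \<otimes> c \<otimes> inv h" if "d \<in> cls p" for d
    using that u assms by (auto simp: group_norm)
  show ?thesis
    unfolding u(1) V_dual_cr_def
    by (simp, rule sum_X[symmetric, of "h \<otimes> c \<otimes> inv h"])
       (use u assms in \<open>auto simp: coef_def cls_conj * zeta_inv\<close>)
qed

lemma act_End_cr:
  assumes "u \<in> X" "v \<in> X" "h \<in> carrier G"
  shows "act (End_cr G scale p) h (u, v) = (\<Sum>u'\<in>X. \<Sum>v'\<in>X. 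
    Poly_Mapping.single (u', v') (coef G scale p h u' u * coef G scale p (inv h) v v'))"
  using assms by (simp add: End_cr_def tensor_crossed_def act_V_cr act_V_dual_cr
      tens_sum_left tens_sum_right tens_single) (rule sum.swap)

lemma basis_End_cr: "basis (End_cr G scale p) = X \<times> X"
  and bdeg_End_cr: "bdeg (End_cr G scale p) (u, v) = fst u \<otimes> inv (fst v)"
  by (auto simp: End_cr_def tensor_crossed_def V_cr_def V_dual_cr_def split_def)

lemma coef_nonzero: "coef G scale p h v u \<noteq> 0 \<Longrightarrow> fst v = h \<otimes> fst u \<otimes> inv h"
  by (auto simp: coef_def split: prod.splits if_splits)

text \<open>Stated for any \<open>M\<close> with the data of \<open>End_cr\<close>, in order to
  serve both the bare crossed module and \<open>End_alg\<close>.\<close>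

lemma block_crossed_End:
  assumes "basis M = basis (End_cr G scale p)" "bdeg M = bdeg (End_cr G scale p)"
    and "act M = act (End_cr G scale p)"
  shows "block_crossed G {()} (\<lambda>_. X) (\<lambda>_. fst) (\<lambda>_. coef G scale p) (\<lambda>_. Pair) M"
proof (unfold_locales, goal_cases)
  case 1 show ?case by (rule finite_X)
next
  case 3 then show ?case by (intro coef_one)
next
  case 4 then show ?case by (intro coef_mult)
next
  case 5 then show ?case by (intro coef_nonzero)
next
  case 6 then show ?case by (auto intro!: inj_onI)
next
  case 9 then show ?case unfolding assms by (intro act_End_cr)
qed (auto simp: assms basis_End_cr bdeg_End_cr)

lemma crossed_module_End_cr: "crossed_module G (End_cr G scale p)"
  using block_crossed.crossed_module_L[OF block_crossed_End[OF refl refl refl]] .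

end

lemma End_bracket_eq:
  assumes "pair_block G scale p" "pair_block G scale p'"
    and u: "u \<in> cls p \<times> vbasis p" and v: "v \<in> cls p \<times> vbasis p"
    and y: "y \<in> basis (End_cr G scale p')"
  shows "End_bracket G scale p p' (u, v) y =
    scl (coef G scale p (inv\<^bsub>G\<^esub> (fst v) \<otimes>\<^bsub>G\<^esub> inv\<^bsub>G\<^esub> bdeg (End_cr G scale p') y \<otimes>\<^bsub>G\<^esub> fst v) v u)
      (act (End_cr G scale p') (inv\<^bsub>G\<^esub> (fst v)) y)"
proof -
  interpret p: pair_block G scale p by fact
  interpret p': pair_block G scale p' by fact
  obtain a i b j where uv: "u = (a, i)" "v = (b, j)" "a \<in> cls p" "b \<in> cls p" using u v by auto
  define m where "m = bdeg (End_cr G scale p') y"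
  note [simp] = uv
  have [simp]: "m \<in> carrier G"
    using y p'.crossed_module_End_cr by (simp add: crossed_module_def m_def)
  define d where "d = inv\<^bsub>G\<^esub> b \<otimes>\<^bsub>G\<^esub> m \<otimes>\<^bsub>G\<^esub> b"
  have hdeg: "hdeg (End_cr G scale p') (act (End_cr G scale p') (inv\<^bsub>G\<^esub> b) y) = d"
    by (subst crossed_module_hdeg[OF p.is_group p'.crossed_module_End_cr _ y]) (simp_all add: d_def m_def)
  have d: "inv\<^bsub>G\<^esub> b \<otimes>\<^bsub>G\<^esub> inv\<^bsub>G\<^esub> m \<otimes>\<^bsub>G\<^esub> b = inv\<^bsub>G\<^esub> d"
    by (simp add: d_def p.group_norm)
  have [simp]: "d \<in> carrier G" by (simp add: d_def)
  \<comment> \<open>Multiplying by \<open>b\<close> on the right and using that \<open>m\<close>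
    times \<open>b\<close> is \<open>b\<close> times \<open>d\<close> makes the degree test
    symmetric.\<close>
  have "a \<otimes>\<^bsub>G\<^esub> inv\<^bsub>G\<^esub> b \<otimes>\<^bsub>G\<^esub> m = d \<longleftrightarrow> a \<otimes>\<^bsub>G\<^esub> inv\<^bsub>G\<^esub> b \<otimes>\<^bsub>G\<^esub> m \<otimes>\<^bsub>G\<^esub> b = d \<otimes>\<^bsub>G\<^esub> b"
    by simp
  also have "a \<otimes>\<^bsub>G\<^esub> inv\<^bsub>G\<^esub> b \<otimes>\<^bsub>G\<^esub> m \<otimes>\<^bsub>G\<^esub> b = a \<otimes>\<^bsub>G\<^esub> d" by (simp add: d_def p.group_norm)
  finally have "a \<otimes>\<^bsub>G\<^esub> inv\<^bsub>G\<^esub> b \<otimes>\<^bsub>G\<^esub> m = d \<longleftrightarrow> a \<otimes>\<^bsub>G\<^esub> d = d \<otimes>\<^bsub>G\<^esub> b" .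
  moreover have "b = inv\<^bsub>G\<^esub> d \<otimes>\<^bsub>G\<^esub> a \<otimes>\<^bsub>G\<^esub> d \<longleftrightarrow> d \<otimes>\<^bsub>G\<^esub> b = d \<otimes>\<^bsub>G\<^esub> (inv\<^bsub>G\<^esub> d \<otimes>\<^bsub>G\<^esub> a \<otimes>\<^bsub>G\<^esub> d)"
    by simp
  then have "b = inv\<^bsub>G\<^esub> d \<otimes>\<^bsub>G\<^esub> a \<otimes>\<^bsub>G\<^esub> d \<longleftrightarrow> a \<otimes>\<^bsub>G\<^esub> d = d \<otimes>\<^bsub>G\<^esub> b"
    by (auto simp: p.group_norm)
  ultimately show ?thesis
    by (simp add: End_bracket_def Let_def hdeg p.bdeg_End_cr coef_def d flip: m_def)
qed

lemma (in pair_block) block_braided_End: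
  "block_braided G {()} (\<lambda>_. X) (\<lambda>_. fst) (\<lambda>_. coef G scale p) (\<lambda>_. Pair) (End_alg G scale p)"
proof (intro block_braided.intro block_braided_axioms.intro, goal_cases)
  case 1
  show ?case
    by (rule block_crossed_End) (simp_all add: End_alg_def)
next
  case (2 s u v)
  then show ?case by (auto simp: End_alg_def End_comult_def sum.cartesian_product split_def)
next
  case (3 s u v)
  then show ?case by (auto simp: End_alg_def End_counit_def split: if_splits)
next
  case (4 s u v y)
  then show ?case
    using End_bracket_eq[OF pair_block_axioms pair_block_axioms] by (simp add: End_alg_def)
qed

section \<open>Direct sums of blocks, fundamental braidings and units\<close>

lemma incl_single: "incl s (Poly_Mapping.single x c) = Poly_Mapping.single (s, x) c"
  by (simp add: incl_def lin_single flip: single_eq_scl)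

lemma incl_sum: "incl s (\<Sum>x\<in>S. f x) = (\<Sum>x\<in>S. incl s (f x))"
  and incl_scl: "incl s (scl c v) = scl c (incl s v)"
  by (simp_all add: incl_def lin_sum lin_scl)

text \<open>The bracket clause of \<open>block_braided\<close> does not look at the block of
  \<open>y\<close>, so brackets between different blocks are covered by
  \<open>End_bracket_eq\<close> for two pairs.\<close>

lemma block_braided_sum:
  assumes "group G" and P: "\<And>s. s \<in> I \<Longrightarrow> pair_block G scale (P s)"
  shows "block_braided G I (\<lambda>s. cls (P s) \<times> vbasis (P s)) (\<lambda>_. fst) (\<lambda>s. coef G scale (P s))
    (\<lambda>s u v. (s, (u, v))) (sum_alg G scale I P)"
proof (intro block_braided.intro block_braided_axioms.intro block_crossed.intro
    block_crossed_axioms.intro, goal_cases)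
  case 1
  show ?case by fact
next
  case 2
  then show ?case by (rule pair_block.finite_X[OF P])
next
  case (3 s u)
  then show ?case by (auto intro: pair_block.cls_closed[OF P])
next
  case 4
  then show ?case by (intro pair_block.coef_one[OF P])
next
  case 5
  then show ?case by (intro pair_block.coef_mult[OF P])
next
  case 6
  then show ?case by (intro pair_block.coef_nonzero[OF P])
next
  case 7
  show ?case by (auto intro!: inj_onI)
next
  case 8
  show ?case by (auto simp: sum_alg_def pair_block.basis_End_cr[OF P])
next
  case 9
  then show ?case by (simp add: sum_alg_def pair_block.bdeg_End_cr[OF P])
next
  case 10
  then show ?case
    by (simp add: sum_alg_def pair_block.act_End_cr[OF P] incl_sum incl_single del: mem_Sigma_iff)
next
  case (11 s u v)
  then show ?case
    by (auto simp: sum_alg_def End_comult_def sum.cartesian_product split_def lin_sum)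
next
  case (12 s u v)
  then show ?case by (auto simp: sum_alg_def End_counit_def split: if_splits)
next
  case (13 s u v y)
  then obtain t z where "y = (t, z)" "t \<in> I" "z \<in> basis (End_cr G scale (P t))"
    by (auto simp: sum_alg_def)
  with 13 show ?case
    by (simp add: sum_alg_def End_bracket_eq[OF P P] incl_scl del: mem_Sigma_iff)
qed

lemma (in pair_block) End_fund_fst_eq:
  "End_fund_fst G scale p p' (u, v) y = act (End_cr G scale p') (inv (fst v)) y"
  by (cases u, cases v) (simp add: End_fund_fst_def)

lemma End_fund_snd_eq:
  assumes "pair_block G scale p" "pair_block G scale p'"
    and u: "u \<in> cls p \<times> vbasis p" and v: "v \<in> cls p \<times> vbasis p"
    and y: "y \<in> basis (End_cr G scale p')"
  shows "End_fund_snd G scale p p' (u, v) y =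
    tens (\<Sum>w\<in>cls p \<times> vbasis p. Poly_Mapping.single w
      (coef G scale p (inv\<^bsub>G\<^esub> (fst v) \<otimes>\<^bsub>G\<^esub> inv\<^bsub>G\<^esub> bdeg (End_cr G scale p') y \<otimes>\<^bsub>G\<^esub> fst v) w u)) (bas v)"
proof -
  interpret p: pair_block G scale p by fact
  interpret p': pair_block G scale p' by fact
  obtain a i b j where uv: "u = (a, i)" "v = (b, j)" "a \<in> cls p" "b \<in> cls p" using u v by auto
  have m: "bdeg (End_cr G scale p') y \<in> carrier G"
    using y p'.crossed_module_End_cr by (simp add: crossed_module_def)
  have hdeg: "hdeg (End_cr G scale p') (act (End_cr G scale p') (inv\<^bsub>G\<^esub> b) y) =
      inv\<^bsub>G\<^esub> b \<otimes>\<^bsub>G\<^esub> bdeg (End_cr G scale p') y \<otimes>\<^bsub>G\<^esub> b"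
    using uv by (subst crossed_module_hdeg[OF p.is_group p'.crossed_module_End_cr _ y]) simp_all
  show ?thesis
    using u uv m unfolding p.act_V_cr[OF u, symmetric]
    by (subst p.act_V_cr[symmetric]) (simp_all add: End_fund_snd_def Let_def hdeg p.group_norm)
qed

lemma (in pair_block) fund_braiding_End:
  assumes "x \<in> basis (End_alg G scale p)" "y \<in> basis (End_alg G scale p)"
  shows "fund_braiding (End_alg G scale p) (x, y) =
    tens (End_fund_fst G scale p p x y) (End_fund_snd G scale p p x y)"
proof -
  interpret E: block_braided G "{()}" "\<lambda>_. X" "\<lambda>_. fst" "\<lambda>_. coef G scale p" "\<lambda>_. Pair"
    "End_alg G scale p" by (rule block_braided_End)
  obtain u v where x: "x = (u, v)" "u \<in> X" "v \<in> X"
    using assms(1) by (rule E.basis_cases) auto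
  have y: "y \<in> basis (End_cr G scale p)" using assms(2) by (simp add: End_alg_def)
  \<comment> \<open>For a single block the embedding is \<open>Pair\<close>, so \<open>ee\<close> is
    just \<open>tens\<close>.\<close>
  have *: "(\<lambda>(u, v). bas (u, v)) = (idm :: _ \<Rightarrow> (('g \<times> 'v) \<times> ('g \<times> 'v)) \<Rightarrow>\<^sub>0 'k)"
    by auto
  show ?thesis
    unfolding x(1) E.fund_braiding_E[OF singletonI x(2,3) assms(2)] E.ee_def * lin_idm E.act_vec_def
      End_fund_fst_eq End_fund_snd_eq[OF pair_block_axioms pair_block_axioms x(2,3) y]
    by (simp add: End_alg_def)
qed

text \<open>The only matrix unit has degree \<open>\<one>\<close>, so its bracket with itself has
  coefficient 1 and reproduces it. The converse is \<open>unital_End_alg_imp_card\<close>.\<close>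

lemma (in pair_block) unital_End:
  assumes "card X = 1"
  shows "unital G (End_alg G scale p)"
proof -
  interpret E: block_braided G "{()}" "\<lambda>_. X" "\<lambda>_. fst" "\<lambda>_. coef G scale p" "\<lambda>_. Pair"
    "End_alg G scale p" by (rule block_braided_End)
  obtain w where w: "X = {w}" using assms by (auto simp: card_1_singleton_iff)
  then have "w \<in> X" by simp
  show ?thesis
  proof (rule E.unital_L[OF singletonI w])
    fix y assume "y \<in> basis (End_alg G scale p)"
    then have y: "y = (w, w)" using w by (auto elim: E.basis_cases)
    show "bracket (End_alg G scale p) ((w, w), y) = bas y"
      using \<open>w \<in> X\<close> E.dg_closed[OF singletonI \<open>w \<in> X\<close>]
      by (simp add: y E.bracket_L[OF singletonI] E.basis_E[OF singletonI] E.bdeg_L[OF singletonI]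
          coef_one E.act_singleton[OF singletonI w] del: mem_Sigma_iff)
  qed
qed

lemma fund_braiding_sum:
  assumes "group G" and P: "\<And>s. s \<in> I \<Longrightarrow> pair_block G scale (P s)"
    and x: "s \<in> I" "x \<in> basis (End_alg G scale (P s))"
    and y: "t \<in> I" "y \<in> basis (End_alg G scale (P t))"
  shows "fund_braiding (sum_alg G scale I P) ((s, x), (t, y)) =
    tens (incl t (End_fund_fst G scale (P s) (P t) x y)) (incl s (End_fund_snd G scale (P s) (P t) x y))"
proof -
  interpret E: block_braided G I "\<lambda>s. cls (P s) \<times> vbasis (P s)" "\<lambda>_. fst" "\<lambda>s. coef G scale (P s)"
    "\<lambda>s u v. (s, (u, v))" "sum_alg G scale I P"
    by (rule block_braided_sum[OF assms(1) P])
  obtain u v where uv: "x = (u, v)" "u \<in> cls (P s) \<times> vbasis (P s)" "v \<in> cls (P s) \<times> vbasis (P s)"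
    using x(2) by (auto simp: End_alg_def pair_block.basis_End_cr[OF P[OF x(1)]])
  have y': "y \<in> basis (End_cr G scale (P t))" using y(2) by (simp add: End_alg_def)
  then have ty: "(t, y) \<in> basis (sum_alg G scale I P)" using y(1) by (simp add: sum_alg_def)
  have *: "(\<lambda>(u, v). bas (s, u, v)) = (\<lambda>x. bas (s, x))" by auto
  show ?thesis
    unfolding uv(1) E.fund_braiding_E[OF x(1) uv(2,3) ty] E.ee_def * E.act_vec_def
      pair_block.End_fund_fst_eq[OF P[OF x(1)]] End_fund_snd_eq[OF P[OF x(1)] P[OF y(1)] uv(2,3) y']
    by (simp add: sum_alg_def incl_def)
qed

lemma unital_sum:
  assumes "group G" and P: "\<And>s. s \<in> I \<Longrightarrow> pair_block G scale (P s)"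
    and z: "z \<in> I" "trivial_pair G scale (P z)"
  shows "unital G (sum_alg G scale I P)"
proof -
  interpret E: block_braided G I "\<lambda>s. cls (P s) \<times> vbasis (P s)" "\<lambda>_. fst" "\<lambda>s. coef G scale (P s)"
    "\<lambda>s u v. (s, (u, v))" "sum_alg G scale I P"
    by (rule block_braided_sum[OF assms(1) P])
  interpret z: pair_block G scale "P z" by (rule P[OF z(1)])
  obtain w where w: "cls (P z) = {\<one>\<^bsub>G\<^esub>}" "vbasis (P z) = {w}"
    using z(2) by (auto simp: trivial_pair_def card_1_singleton_iff)
  \<comment> \<open>The bracket of the trivial block with \<open>y\<close> has
    \<open>inv (bdeg L y)\<close> as exponent, up to conjugation by the identity; triviality of the
    representation makes the coefficient 1 for every such element.\<close>
  have coef: "coef G scale (P z) h (\<one>\<^bsub>G\<^esub>, w) (\<one>\<^bsub>G\<^esub>, w) = 1" if h: "h \<in> carrier G" for h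
  proof -
    have "rep (P z) (zeta G (P z) \<one>\<^bsub>G\<^esub> h) w = w"
      using z(2) w z.zeta_centraliser[of "\<one>\<^bsub>G\<^esub>" h] h
      by (simp add: trivial_pair_def z.centraliser_closed z.span_base)
    then show ?thesis
      using h w z.independent_vbasis by (simp add: coef_def mat_def z.representation_basis)
  qed
  show ?thesis
  proof (rule E.unital_L[OF z(1)])
    show "cls (P z) \<times> vbasis (P z) = {(\<one>\<^bsub>G\<^esub>, w)}" using w by simp
    fix y assume "y \<in> basis (sum_alg G scale I P)"
    then show "bracket (sum_alg G scale I P) ((z, ((\<one>\<^bsub>G\<^esub>, w), (\<one>\<^bsub>G\<^esub>, w))), y) = bas y"
      by (simp add: E.bracket_L[OF z(1)] w coef E.act_one)
  qed
qed

text \<open>A grouplike element exists in a single block only in dimension one, hence the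
  equivalence for \<open>unital\<close>. In general the unit lies in an adjoined trivial block
  \<open>z\<close>, which is a new index because the pairs over \<open>I\<close> are
  non-trivial.\<close>

theorem proposition5p3:
  fixes G :: "('g, 'a) monoid_scheme"
    and scale :: "'k::field \<Rightarrow> 'v::ab_group_add \<Rightarrow> 'v"
    and p :: "('g, 'v) pair_data"
    and I :: "'i set" and P :: "'i \<Rightarrow> ('g, 'v) pair_data"
  assumes "group G" and "finite (carrier G)" and "vector_space scale"
    and "class_irrep_pair G scale p"
    and "\<And>s. s \<in> I \<Longrightarrow> class_irrep_pair G scale (P s) \<and> \<not> trivial_pair G scale (P s)"
  shows "(\<forall>a\<in>cls p. \<forall>i\<in>vbasis p. \<forall>b\<in>cls p. \<forall>j\<in>vbasis p.
           (\<forall>h\<in>carrier G. act (End_alg G scale p) h ((a, i), (b, j)) =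
              (\<Sum>m\<in>vbasis p. \<Sum>n\<in>vbasis p.
                 Poly_Mapping.single
                   ((h \<otimes>\<^bsub>G\<^esub> a \<otimes>\<^bsub>G\<^esub> inv\<^bsub>G\<^esub> h, m), (h \<otimes>\<^bsub>G\<^esub> b \<otimes>\<^bsub>G\<^esub> inv\<^bsub>G\<^esub> h, n))
                   (mat scale p (zeta G p a h) m i * mat scale p (inv\<^bsub>G\<^esub> (zeta G p b h)) j n))) \<and>
           bdeg (End_alg G scale p) ((a, i), (b, j)) = a \<otimes>\<^bsub>G\<^esub> inv\<^bsub>G\<^esub> b)
       \<and> crossed_module G (End_alg G scale p)
       \<and> left_braided_Lie_algebra G (End_alg G scale p)
       \<and> regular G (End_alg G scale p)
       \<and> (unital G (End_alg G scale p) \<longleftrightarrow> card (cls p \<times> vbasis p) = 1)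
       \<and> (\<forall>x\<in>basis (End_alg G scale p). \<forall>y\<in>basis (End_alg G scale p).
            fund_braiding (End_alg G scale p) (x, y) =
            tens (End_fund_fst G scale p p x y) (End_fund_snd G scale p p x y))
       \<and> left_braided_Lie_algebra G (sum_alg G scale I P)
       \<and> regular G (sum_alg G scale I P)
       \<and> (\<forall>s\<in>I. \<forall>x\<in>basis (End_alg G scale (P s)). \<forall>t\<in>I. \<forall>y\<in>basis (End_alg G scale (P t)).
            fund_braiding (sum_alg G scale I P) ((s, x), (t, y)) =
            tens (incl t (End_fund_fst G scale (P s) (P t) x y))
                 (incl s (End_fund_snd G scale (P s) (P t) x y)))
       \<and> (\<forall>z. class_irrep_pair G scale (P z) \<longrightarrow> trivial_pair G scale (P z) \<longrightarrow>
            left_braided_Lie_algebra G (sum_alg G scale (insert z I) P) \<and>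
            regular G (sum_alg G scale (insert z I) P) \<and>
            unital G (sum_alg G scale (insert z I) P))"
proof -
  have *: "pair_block G scale p'" if "class_irrep_pair G scale p'" for p'
    using assms(1-3) that by (simp add: pair_block_def pair_block_axioms_def)
  note P = *[OF conjunct1[OF assms(5)]]
  interpret pair_block G scale p by (rule *[OF assms(4)])
  interpret E: block_braided G "{()}" "\<lambda>_. X" "\<lambda>_. fst" "\<lambda>_. coef G scale p" "\<lambda>_. Pair"
    "End_alg G scale p" by (rule block_braided_End)
  note S = block_braided_sum[OF assms(1)]
  show ?thesis
  proof (intro conjI ballI allI impI)
    fix a i b j h
    assume ai: "a \<in> cls p" "i \<in> vbasis p" "b \<in> cls p" "j \<in> vbasis p"
    show "bdeg (End_alg G scale p) ((a, i), (b, j)) = a \<otimes>\<^bsub>G\<^esub> inv\<^bsub>G\<^esub> b"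
      by (simp add: End_alg_def bdeg_End_cr)
    assume h: "h \<in> carrier G"
    show "act (End_alg G scale p) h ((a, i), (b, j)) =
        (\<Sum>m\<in>vbasis p. \<Sum>n\<in>vbasis p. Poly_Mapping.single
          ((h \<otimes>\<^bsub>G\<^esub> a \<otimes>\<^bsub>G\<^esub> inv\<^bsub>G\<^esub> h, m), (h \<otimes>\<^bsub>G\<^esub> b \<otimes>\<^bsub>G\<^esub> inv\<^bsub>G\<^esub> h, n))
          (mat scale p (zeta G p a h) m i * mat scale p (inv\<^bsub>G\<^esub> (zeta G p b h)) j n))"
      by (simp add: End_alg_def End_cr_def tensor_crossed_def V_cr_def V_dual_cr_def
          tens_sum_left tens_sum_right tens_single) (rule sum.swap)
  next
    show "unital G (End_alg G scale p) \<longleftrightarrow> card X = 1"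
      using unital_End unital_End_alg_imp_card finite_cls finite_vbasis by blast
  next
    fix z assume z: "class_irrep_pair G scale (P z)" "trivial_pair G scale (P z)"
    have Pz: "pair_block G scale (P s)" if "s \<in> insert z I" for s
      using that P *[OF z(1)] by blast
    show "left_braided_Lie_algebra G (sum_alg G scale (insert z I) P)"
      by (rule block_braided.left_braided_Lie[OF S[OF Pz]])
    show "regular G (sum_alg G scale (insert z I) P)"
      by (rule block_braided.regular_L[OF S[OF Pz]])
    show "unital G (sum_alg G scale (insert z I) P)"
      by (rule unital_sum[where z = z]) (use assms(1) Pz z(2) in auto)
  qed (simp_all add: E.crossed_module_L E.left_braided_Lie E.regular_L fund_braiding_End
      block_braided.left_braided_Lie[OF S[OF P]] block_braided.regular_L[OF S[OF P]]
      fund_braiding_sum[OF assms(1) P])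
qed

end
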